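(* Let $N\ge 2$ be an integer and consider the generalized eigenvalue problem: find $\lambda^N\in\mathbb{R}$ and $(\vec{u},\vec{v},\vec{w})\neq(0,0,0)$, where $\vec u=\mathrm{vec}(\mathbf{U})$, $\vec v=\mathrm{vec}(\mathbf{V})$, $\vec w=\mathrm{vec}(\mathbf{W})$ with $\mathbf{U}\in\mathbb{R}^{N\times(N-1)\times(N-1)}$, $\mathbf{V}\in\mathbb{R}^{(N-1)\times N\times(N-1)}$, $\mathbf{W}\in\mathbb{R}^{(N-1)\times(N-1)\times N}$, such that $$ \begin{pmatrix} \mathbf{A}_{11}&\mathbf{A}_{12}&\mathbf{A}_{13}\\ \mathbf{A}_{21}&\mathbf{A}_{22}&\mathbf{A}_{23}\\ \mathbf{A}_{31}&\mathbf{A}_{32}&\mathbf{A}_{33} \end{pmatrix} \begin{pmatrix}\vec u\\ \vec v\\ \vec w\end{pmatrix} =\lambda^N \begin{pmatrix} \mathbf{A}_1&0&0\\0&\mathbf{A}_2&0\\0&0&\mathbf{A}_3 \end{pmatrix} \begin{pmatrix}\vec u\\ \vec v\\ \vec w\end{pmatrix}, $$ with $$\mathbf{A}_{11}=\mathbf{I}_{N-1}\otimes\mathbf{M}\otimes\mathbf{I}_N+\mathbf{M}\otimes\mathbf{I}_{N-1}\otimes\mathbf{I}_N,\quad \mathbf{A}_{22}=\mathbf{I}_{N-1}\otimes\mathbf{I}_N\otimes\mathbf{M}+\mathbf{M}\otimes\mathbf{I}_N\otimes\mathbf{I}_{N-1},$$ $$\mathbf{A}_{33}=\mathbf{I}_N\otimes\mathbf{I}_{N-1}\otimes\mathbf{M}+\mathbf{I}_N\otimes\mathbf{M}\otimes\mathbf{I}_{N-1},$$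 $$\mathbf{A}_{12}=\mathbf{A}_{21}^{\top}=-\mathbf{M}\otimes\mathbf{E}\otimes\mathbf{E}^{\top},\quad \mathbf{A}_{13}=\mathbf{A}_{31}^{\top}=-\mathbf{E}\otimes\mathbf{M}\otimes\mathbf{E}^{\top},\quad \mathbf{A}_{23}=\mathbf{A}_{32}^{\top}=-\mathbf{E}\otimes\mathbf{E}^{\top}\otimes\mathbf{M},$$ $$\mathbf{A}_1=\mathbf{M}\otimes\mathbf{M}\otimes\mathbf{I}_N,\quad \mathbf{A}_2=\mathbf{M}\otimes\mathbf{I}_N\otimes\mathbf{M},\quad \mathbf{A}_3=\mathbf{I}_N\otimes\mathbf{M}\otimes\mathbf{M}.$$ For vectors $\vec U^1,\vec U^2,\vec U^3\in\mathbb{R}^{(N-1)^3}$ and $\vec U^x,\vec U^y,\vec U^z\in\mathbb{R}^{(N-1)^2}$ put $$\vec u=(\mathbf{I}_{N-1}\otimes\mathbf{I}_{N-1}\otimes\mathbf{E}^{\top})\vec U^1+(\mathbf{I}_{N-1}\otimes\mathbf{I}_{N-1}\otimes \mathbf{e}_1)\vec U^x,$$ $$\vec v=(\mathbf{I}_{N-1}\otimes\mathbf{E}^{\top}\otimes\mathbf{I}_{N-1})\vec U^2+(\mathbf{I}_{N-1}\otimes \mathbf{e}_1\otimes\mathbf{I}_{N-1})\vec U^y,$$ $$\vec w=(\mathbf{E}^{\top}\otimes\mathbf{I}_{N-1}\otimes\mathbf{I}_{N-1})\vec U^3+(\mathbf{e}_1\otimes\mathbf{I}_{N-1}\otimes\mathbf{I}_{N-1})\vec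 U^z. \qquad( * )$$ Then the eigen-solutions $(\lambda^N,\vec u,\vec v,\vec w)$ of the problem are exactly those obtained through $( * )$ from the following data, in the sense that each item listed gives an eigen-solution and every eigenvector with eigenvalue $\lambda$ is a linear combination of the listed eigenvectors with eigenvalue $\lambda$. (A) Eigen-solutions with non-zero eigenvalue: (A1) For each $1\le i,j,k\le N-1$, the eigenvalue $$\lambda^N_{ijk}=\frac1{d_i}+\frac1{d_j}+\frac1{d_k},$$ with multiplicity $2$ (for each index triple $(i,j,k)$), with two linearly independent eigenvectors given by $\vec U^x=\vec U^y=\vec U^z=\vec 0$ and, respectively, $$\vec U^1=(\mathbf{Q}\otimes\mathbf{Q}\otimes\mathbf{Q})\vec I_{ijk},\quad \vec U^2=\vec 0,\quad \vec U^3=-(\mathbf{Q}\otimes\mathbf{Q}\otimes\mathbf{Q})\Big(\frac{d_k}{d_i}\vec I_{ijk}\Big),$$ and $$\vec U^1=\vec 0,\quad \vec U^2=(\mathbf{Q}\otimes\mathbf{Q}\otimes\mathbf{Q})\vec I_{ijk},\quad \vec U^3=-(\mathbf{Q}\otimes\mathbf{Q}\otimes\mathbf{Q})\Big(\frac{d_k}{d_j}\vec I_{ijk}\Big).$$ (A2) For $i=0$ and $1\le j,k\le N-1$: $\lambda^N_{0jk}=\frac1{d_j}+\frac1{d_k}$, with $\vec U^x=\mathrm{vec}(\mathbf{Q}\,\mathbf{I}_{jk}\,\mathbf{Q}^{\top})$ and $\vec U^1=\vec U^2=\vec U^3=\vec 0$, $\vec U^y=\vec U^z=\vec 0$. (A3)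 For $j=0$ and $1\le i,k\le N-1$: $\lambda^N_{i0k}=\frac1{d_i}+\frac1{d_k}$, with $\vec U^y=\mathrm{vec}(\mathbf{Q}\,\mathbf{I}_{ik}\,\mathbf{Q}^{\top})$ and $\vec U^1=\vec U^2=\vec U^3=\vec 0$, $\vec U^x=\vec U^z=\vec 0$. (A4) For $k=0$ and $1\le i,j\le N-1$: $\lambda^N_{ij0}=\frac1{d_i}+\frac1{d_j}$, with $\vec U^z=\mathrm{vec}(\mathbf{Q}\,\mathbf{I}_{ij}\,\mathbf{Q}^{\top})$ and $\vec U^1=\vec U^2=\vec U^3=\vec 0$, $\vec U^x=\vec U^y=\vec 0$. (B) Eigen-solutions with zero eigenvalue: for each $1\le i,j,k\le N-1$, $\lambda^N_{ijk}=0$, with $$\vec U^1=\vec U^2=\vec U^3=(\mathbf{Q}\otimes\mathbf{Q}\otimes\mathbf{Q})\vec I_{ijk},\qquad \vec U^x=\vec U^y=\vec U^z=\vec 0.$$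
   Context: Notation. $\mathbf{I}_n$ is the $n\times n$ identity matrix, $\otimes$ is the Kronecker product, and $\mathrm{vec}$ is the vectorization of a matrix or 3-index array in the standard column-wise linear index order (first index varies fastest, then the second, then the third); thus in $\mathbf{A}\otimes\mathbf{B}\otimes\mathbf{C}$ acting on $\mathrm{vec}(\mathbf{X})$, $\mathbf{C}$ acts on the first index, $\mathbf{B}$ on the second and $\mathbf{A}$ on the third. $\mathbf{e}_1\in\mathbb{R}^{N\times 1}$ is the first canonical basis vector of $\mathbb{R}^N$, and $\mathbf{E}\in\mathbb{R}^{(N-1)\times N}$ is $\mathbf{I}_N$ with its first row removed. $\mathbf{I}_{ij}$ is the $(N-1)\times(N-1)$ matrix with $(i,j)$ entry $1$ and all other entries $0$; $\vec I_{ijk}=\mathrm{vec}(\mathbf{I}_{ijk})$, where $\mathbf{I}_{ijk}$ is the $(N-1)\times(N-1)\times(N-1)$ array with $(i,j,k)$ entry $1$ and all other entries $0$. $\vec 0$ denotes a zero vector of the appropriate length. The matrix $\mathbf{M}=(M_{mn})_{1\le m,n\le N-1}$ is the symmetric (positive definite) Gram matrix $M_{mn}=\int_{-1}^1\psi_{n+1}(\xi)\psi_{m+1}(\xi)\,d\xi$, where $\psi_{m+1}(\xi)=\frac{1}{\sqrt{2(2m+1)}}\big(L_{m+1}(\xi)-L_{m-1}(\xi)\big)$ and $L_m$ is the Legendre polynomial of degree $m$. Explicitly, $M_{nn}=\frac{1}{2n+1}\big(\frac1{2n-1}+\frac1{2n+3}\big)$, $M_{n+2,n}=M_{n,n+2}=-\frac{1}{\sqrt{2n+1}\,\sqrt{2n+5}\,(2n+3)}$,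 and all other entries are $0$. $\mathbf{M}=\mathbf{Q}\mathbf{D}\mathbf{Q}^{\top}$ is an orthogonal diagonalization: $\mathbf{Q}\mathbf{Q}^{\top}=\mathbf{Q}^{\top}\mathbf{Q}=\mathbf{I}_{N-1}$ and $\mathbf{D}=\mathrm{diag}(d_1,\dots,d_{N-1})$, where the $d_i>0$ are the eigenvalues of $\mathbf{M}$. The generalized eigenvalue problem is the algebraic form of the $H(\mathrm{curl})$-conforming Legendre spectral discretization of the three-dimensional Maxwell double-curl eigenvalue problem on $(-1,1)^3$. *)

theory Defs
  imports
    "HOL-Analysis.Analysis"
    "HOL-Computational_Algebra.Polynomial"
    "Jordan_Normal_Form.VS_Connect"
begin

unbundle no vec_syntax
hide_const (open) Finite_Cartesian_Product.vec Determinants.det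

text \<open>
  Rows, columns and vector entries are numbered from 0 by the matrix library. The mathematical
  indices \<open>i, j, k, m, n\<close> below run from 1, as do the eigenvalues \<open>d 1, \<dots>, d (N - 1)\<close>; the shift
  is made only where a matrix, vector or array is built.
\<close>

definition kron :: "real mat \<Rightarrow> real mat \<Rightarrow> real mat"  (infixl "\<otimes>\<^sub>k" 75) where
  "A \<otimes>\<^sub>k B = mat (dim_row A * dim_row B) (dim_col A * dim_col B)
     (\<lambda>(r, c). A $$ (r div dim_row B, c div dim_col B) * B $$ (r mod dim_row B, c mod dim_col B))"

text \<open>The first index varies fastest.\<close>

definition vec_mat :: "real mat \<Rightarrow> real vec" where
  "vec_mat A = vec (dim_row A * dim_col A) (\<lambda>p. A $$ (p mod dim_row A, p div dim_row A))"

definition vec_arr :: "nat \<Rightarrow> nat \<Rightarrow> nat \<Rightarrow> (nat \<Rightarrow> nat \<Rightarrow> nat \<Rightarrow> real) \<Rightarrow> real vec" where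
  "vec_arr n1 n2 n3 X =
     vec (n1 * n2 * n3) (\<lambda>p. X (p mod n1) (p div n1 mod n2) (p div (n1 * n2)))"

text \<open>
  Quantifying over the arrays of a given shape amounts to quantifying over all vectors of
  the corresponding length.
\<close>

lemma range_vec_arr: "range (vec_arr n1 n2 n3) = carrier_vec (n1 * n2 * n3)"
proof
  show "range (vec_arr n1 n2 n3) \<subseteq> carrier_vec (n1 * n2 * n3)"
    by (auto simp: vec_arr_def)
  show "carrier_vec (n1 * n2 * n3) \<subseteq> range (vec_arr n1 n2 n3)"
  proof
    fix x :: "real vec" assume x: "x \<in> carrier_vec (n1 * n2 * n3)"
    have *: "p mod n1 + n1 * (p div n1 mod n2 + n2 * (p div (n1 * n2))) = p" for p :: nat
      by (simp add: div_mult2_eq)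
    have "x = vec_arr n1 n2 n3 (\<lambda>a b c. x $ (a + n1 * (b + n2 * c)))"
      using x by (intro eq_vecI) (auto simp: vec_arr_def *)
    then show "x \<in> range (vec_arr n1 n2 n3)" by blast
  qed
qed

text \<open>Legendre polynomials, by Rodrigues' formula.\<close>

definition legendre :: "nat \<Rightarrow> real poly" where
  "legendre n = Polynomial.smult (1 / (2 ^ n * fact n)) ((pderiv ^^ n) ([:-1, 0, 1:] ^ n))"

text \<open>\<open>psi_Suc m\<close> is \<open>\<psi>\<close> with index \<open>m + 1\<close>; it is used for \<open>m \<ge> 1\<close> only.\<close>

definition psi_Suc :: "nat \<Rightarrow> real \<Rightarrow> real" where
  "psi_Suc m \<xi> =
     1 / sqrt (2 * (2 * real m + 1)) * (poly (legendre (m + 1)) \<xi> - poly (legendre (m - 1)) \<xi>)"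

definition gram_entry :: "nat \<Rightarrow> nat \<Rightarrow> real" where
  "gram_entry m n = integral {-1..1} (\<lambda>\<xi>. psi_Suc n \<xi> * psi_Suc m \<xi>)"

definition gram :: "nat \<Rightarrow> real mat" where
  "gram N = mat (N - 1) (N - 1) (\<lambda>(r, c). gram_entry (Suc r) (Suc c))"

definition Emat :: "nat \<Rightarrow> real mat" where
  "Emat N = mat (N - 1) N (\<lambda>(r, c). 1\<^sub>m N $$ (Suc r, c))"

definition e1 :: "nat \<Rightarrow> real mat" where
  "e1 N = mat N 1 (\<lambda>(r, c). if r = 0 then 1 else 0)"

context
  fixes N :: nat
begin

definition A11 :: "real mat" where
  "A11 = 1\<^sub>m (N - 1) \<otimes>\<^sub>k gram N \<otimes>\<^sub>k 1\<^sub>m N + gram N \<otimes>\<^sub>k 1\<^sub>m (N - 1) \<otimes>\<^sub>k 1\<^sub>m N"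

definition A22 :: "real mat" where
  "A22 = 1\<^sub>m (N - 1) \<otimes>\<^sub>k 1\<^sub>m N \<otimes>\<^sub>k gram N + gram N \<otimes>\<^sub>k 1\<^sub>m N \<otimes>\<^sub>k 1\<^sub>m (N - 1)"

definition A33 :: "real mat" where
  "A33 = 1\<^sub>m N \<otimes>\<^sub>k 1\<^sub>m (N - 1) \<otimes>\<^sub>k gram N + 1\<^sub>m N \<otimes>\<^sub>k gram N \<otimes>\<^sub>k 1\<^sub>m (N - 1)"

definition A12 :: "real mat" where
  "A12 = - (gram N \<otimes>\<^sub>k Emat N \<otimes>\<^sub>k transpose_mat (Emat N))"

definition A13 :: "real mat" where
  "A13 = - (Emat N \<otimes>\<^sub>k gram N \<otimes>\<^sub>k transpose_mat (Emat N))"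

definition A23 :: "real mat" where
  "A23 = - (Emat N \<otimes>\<^sub>k transpose_mat (Emat N) \<otimes>\<^sub>k gram N)"

definition A21 :: "real mat" where "A21 = transpose_mat A12"
definition A31 :: "real mat" where "A31 = transpose_mat A13"
definition A32 :: "real mat" where "A32 = transpose_mat A23"

definition A1 :: "real mat" where "A1 = gram N \<otimes>\<^sub>k gram N \<otimes>\<^sub>k 1\<^sub>m N"
definition A2 :: "real mat" where "A2 = gram N \<otimes>\<^sub>k 1\<^sub>m N \<otimes>\<^sub>k gram N"
definition A3 :: "real mat" where "A3 = 1\<^sub>m N \<otimes>\<^sub>k gram N \<otimes>\<^sub>k gram N"

text \<open>The length of each of the three component vectors.\<close>

definition len :: nat where "len = N * (N - 1) * (N - 1)"

end

text \<open>The 3 by 3 block matrix with rows \<open>(A, B, C)\<close>, \<open>(D, E, F)\<close>, \<open>(G, H, K)\<close>.\<close>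

definition block3 :: "real mat \<Rightarrow> real mat \<Rightarrow> real mat \<Rightarrow> real mat \<Rightarrow> real mat \<Rightarrow> real mat \<Rightarrow>
    real mat \<Rightarrow> real mat \<Rightarrow> real mat \<Rightarrow> real mat" where
  "block3 A B C D E F G H K =
     four_block_mat (four_block_mat A B D E) (C @\<^sub>r F)
       (four_block_mat G H (0\<^sub>m 0 (dim_col G)) (0\<^sub>m 0 (dim_col H))) K"

definition stiffness :: "nat \<Rightarrow> real mat" where
  "stiffness N = block3
     (A11 N) (A12 N) (A13 N)
     (A21 N) (A22 N) (A23 N)
     (A31 N) (A32 N) (A33 N)"

definition mass :: "nat \<Rightarrow> real mat" where
  "mass N = (let Z = 0\<^sub>m (len N) (len N) in block3
     (A1 N) Z Z
     Z (A2 N) Z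
     Z Z (A3 N))"

fun stack :: "real vec \<times> real vec \<times> real vec \<Rightarrow> real vec" where
  "stack (u, v, w) = u @\<^sub>v v @\<^sub>v w"

fun eigen_solution :: "nat \<Rightarrow> real \<Rightarrow> real vec \<times> real vec \<times> real vec \<Rightarrow> bool" where
  "eigen_solution N lam (u, v, w) \<longleftrightarrow>
     u \<in> range (vec_arr N (N - 1) (N - 1)) \<and>
     v \<in> range (vec_arr (N - 1) N (N - 1)) \<and>
     w \<in> range (vec_arr (N - 1) (N - 1) N) \<and>
     (u, v, w) \<noteq> (0\<^sub>v (len N), 0\<^sub>v (len N), 0\<^sub>v (len N)) \<and>
     stiffness N *\<^sub>v stack (u, v, w) = lam \<cdot>\<^sub>v (mass N *\<^sub>v stack (u, v, w))"

definition assemble :: "nat \<Rightarrow> real vec \<Rightarrow> real vec \<Rightarrow> real vec \<Rightarrow> real vec \<Rightarrow> real vec \<Rightarrow> real vec \<Rightarrow>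
    real vec \<times> real vec \<times> real vec" where
  "assemble N U1 U2 U3 Ux Uy Uz =
     (let I = 1\<^sub>m (N - 1); Et = transpose_mat (Emat N) in
      ((I \<otimes>\<^sub>k I \<otimes>\<^sub>k Et) *\<^sub>v U1 + (I \<otimes>\<^sub>k I \<otimes>\<^sub>k e1 N) *\<^sub>v Ux,
       (I \<otimes>\<^sub>k Et \<otimes>\<^sub>k I) *\<^sub>v U2 + (I \<otimes>\<^sub>k e1 N \<otimes>\<^sub>k I) *\<^sub>v Uy,
       (Et \<otimes>\<^sub>k I \<otimes>\<^sub>k I) *\<^sub>v U3 + (e1 N \<otimes>\<^sub>k I \<otimes>\<^sub>k I) *\<^sub>v Uz))"

definition unit_mat :: "nat \<Rightarrow> nat \<Rightarrow> nat \<Rightarrow> real mat" where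
  "unit_mat N i j = mat (N - 1) (N - 1) (\<lambda>(r, c). if Suc r = i \<and> Suc c = j then 1 else 0)"

definition unit_arr :: "nat \<Rightarrow> nat \<Rightarrow> nat \<Rightarrow> nat \<Rightarrow> real vec" where
  "unit_arr N i j k = vec_arr (N - 1) (N - 1) (N - 1)
     (\<lambda>a b c. if Suc a = i \<and> Suc b = j \<and> Suc c = k then 1 else 0)"

text \<open>
  Labels of the listed eigen-solutions: \<open>Interior1\<close> and \<open>Interior2\<close> are the two eigenvectors
  attached to an index triple with all three indices positive, \<open>FaceX\<close>, \<open>FaceY\<close>, \<open>FaceZ\<close> belong to
  the triples whose first, second, third index is 0 (only the two positive indices are kept),
  and \<open>Kernel\<close> labels the eigenvalue zero.
\<close>

datatype mode =
    Interior1 nat nat nat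
  | Interior2 nat nat nat
  | FaceX nat nat
  | FaceY nat nat
  | FaceZ nat nat
  | Kernel nat nat nat

fun mode_indices :: "mode \<Rightarrow> nat set" where
  "mode_indices (Interior1 i j k) = {i, j, k}"
| "mode_indices (Interior2 i j k) = {i, j, k}"
| "mode_indices (FaceX j k) = {j, k}"
| "mode_indices (FaceY i k) = {i, k}"
| "mode_indices (FaceZ i j) = {i, j}"
| "mode_indices (Kernel i j k) = {i, j, k}"

definition modes :: "nat \<Rightarrow> mode set" where
  "modes N = {p. mode_indices p \<subseteq> {1..N - 1}}"

text \<open>
  The divisors \<open>d i\<close> are the eigenvalues of the positive definite matrix \<open>gram N\<close>, hence positive.
\<close>

fun mode_eigenvalue :: "(nat \<Rightarrow> real) \<Rightarrow> mode \<Rightarrow> real" where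
  "mode_eigenvalue d (Interior1 i j k) = 1 / d i + 1 / d j + 1 / d k"
| "mode_eigenvalue d (Interior2 i j k) = 1 / d i + 1 / d j + 1 / d k"
| "mode_eigenvalue d (FaceX j k) = 1 / d j + 1 / d k"
| "mode_eigenvalue d (FaceY i k) = 1 / d i + 1 / d k"
| "mode_eigenvalue d (FaceZ i j) = 1 / d i + 1 / d j"
| "mode_eigenvalue d (Kernel i j k) = 0"

fun mode_solution ::
  "nat \<Rightarrow> real mat \<Rightarrow> (nat \<Rightarrow> real) \<Rightarrow> mode \<Rightarrow> real vec \<times> real vec \<times> real vec" where
  "mode_solution N Q d (Interior1 i j k) =
     (let z3 = 0\<^sub>v ((N - 1) ^ 3); z2 = 0\<^sub>v ((N - 1) ^ 2) in
      assemble N ((Q \<otimes>\<^sub>k Q \<otimes>\<^sub>k Q) *\<^sub>v unit_arr N i j k)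
                 z3
                 (- ((Q \<otimes>\<^sub>k Q \<otimes>\<^sub>k Q) *\<^sub>v ((d k / d i) \<cdot>\<^sub>v unit_arr N i j k)))
                 z2 z2 z2)"
| "mode_solution N Q d (Interior2 i j k) =
     (let z3 = 0\<^sub>v ((N - 1) ^ 3); z2 = 0\<^sub>v ((N - 1) ^ 2) in
      assemble N z3
                 ((Q \<otimes>\<^sub>k Q \<otimes>\<^sub>k Q) *\<^sub>v unit_arr N i j k)
                 (- ((Q \<otimes>\<^sub>k Q \<otimes>\<^sub>k Q) *\<^sub>v ((d k / d j) \<cdot>\<^sub>v unit_arr N i j k)))
                 z2 z2 z2)"
| "mode_solution N Q d (FaceX j k) =
     (let z3 = 0\<^sub>v ((N - 1) ^ 3); z2 = 0\<^sub>v ((N - 1) ^ 2) in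
      assemble N z3 z3 z3 (vec_mat (Q * unit_mat N j k * transpose_mat Q)) z2 z2)"
| "mode_solution N Q d (FaceY i k) =
     (let z3 = 0\<^sub>v ((N - 1) ^ 3); z2 = 0\<^sub>v ((N - 1) ^ 2) in
      assemble N z3 z3 z3 z2 (vec_mat (Q * unit_mat N i k * transpose_mat Q)) z2)"
| "mode_solution N Q d (FaceZ i j) =
     (let z3 = 0\<^sub>v ((N - 1) ^ 3); z2 = 0\<^sub>v ((N - 1) ^ 2) in
      assemble N z3 z3 z3 z2 z2 (vec_mat (Q * unit_mat N i j * transpose_mat Q)))"
| "mode_solution N Q d (Kernel i j k) =
     (let z2 = 0\<^sub>v ((N - 1) ^ 2); t = (Q \<otimes>\<^sub>k Q \<otimes>\<^sub>k Q) *\<^sub>v unit_arr N i j k in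
      assemble N t t t z2 z2 z2)"

definition rspan :: "nat \<Rightarrow> real vec set \<Rightarrow> real vec set" where
  "rspan n S = LinearCombinations.module.span class_ring (module_vec TYPE(real) n) S"

text \<open>
  Linear independence of a family, so that a repeated vector counts as a dependence.
\<close>

definition lin_indep_family :: "nat \<Rightarrow> ('i \<Rightarrow> real vec) \<Rightarrow> 'i set \<Rightarrow> bool" where
  "lin_indep_family n f T \<longleftrightarrow> inj_on f T \<and> f ` T \<subseteq> carrier_vec n \<and>
     \<not> LinearCombinations.module.lin_dep class_ring (module_vec TYPE(real) n) (f ` T)"

end

theory Submission
  imports Defs
begin

text \<open>
  Let \<open>K\<close> be the stiffness and \<open>B\<close> the mass matrix, both symmetric, and put \<open>n = N - 1\<close>. Both are
  built from Kronecker products of the Gram matrix \<open>M\<close>, the matrix \<open>E\<close> and identities, so they are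
  evaluated on product vectors factor by factor. Let \<open>q\<^sub>1, \<dots>, q\<^sub>n\<close> be the columns of \<open>Q\<close>, put
  \<open>q\<^sub>0 = 0\<close>, and extend by \<open>h\<^sub>0 = e\<^sub>1\<close>, \<open>h\<^sub>i = E\<^sup>T q\<^sub>i\<close> to an orthonormal basis in dimension \<open>N\<close>, so
  that \<open>E h\<^sub>i = q\<^sub>i\<close> for all \<open>i\<close>. In the products
  \<open>F1 = q\<^sub>k \<otimes> q\<^sub>j \<otimes> h\<^sub>i\<close>, \<open>F2 = q\<^sub>k \<otimes> h\<^sub>j \<otimes> q\<^sub>i\<close>, \<open>F3 = h\<^sub>k \<otimes> q\<^sub>j \<otimes> q\<^sub>i\<close> the problem decouples:
  for each index triple \<open>(i, j, k)\<close> it is the 3 by 3 problem with mass matrix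
  \<open>diag (d\<^sub>j d\<^sub>k, d\<^sub>i d\<^sub>k, d\<^sub>i d\<^sub>j)\<close> and stiffness matrix with rows \<open>(d\<^sub>j + d\<^sub>k, - d\<^sub>k, - d\<^sub>j)\<close>,
  \<open>(- d\<^sub>k, d\<^sub>i + d\<^sub>k, - d\<^sub>i)\<close>, \<open>(- d\<^sub>j, - d\<^sub>i, d\<^sub>i + d\<^sub>j)\<close>. If exactly one index
  is 0, then only one of \<open>F1\<close>, \<open>F2\<close>, \<open>F3\<close> is non-zero and the problem is scalar. Solving these
  small problems gives the listed modes (\<open>triple_eigen\<close>, \<open>stiffness_eq_mass\<close>, \<open>mode_solution_eq_triple\<close>).

  The \<open>d\<^sub>i\<close> are positive because \<open>M\<close> is the Gram matrix of polynomials of distinct degrees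
  (\<open>gram_pos_def\<close>, \<open>d_pos\<close>).

  For independence and completeness each mode \<open>p\<close> with eigenvector \<open>s\<^sub>p\<close> gets a vector \<open>r\<^sub>p\<close> with
  \<open>s\<^sub>p \<bullet> B r\<^sub>p > 0\<close> and \<open>s\<^sub>p \<bullet> B r\<^sub>p\<^sub>' = 0\<close> for \<open>p \<noteq> p'\<close> (\<open>mode_dual_pos\<close>, \<open>mode_dual_orthogonal\<close>).
  Hence the \<open>s\<^sub>p\<close> are independent, and since there are as many modes as dimensions (\<open>card_modes\<close>),
  they form a basis in which the coefficient of \<open>s\<^sub>p\<close> in \<open>x\<close> is a multiple of \<open>x \<bullet> B r\<^sub>p\<close>. The \<open>r\<^sub>p\<close>
  satisfy \<open>K r\<^sub>p = \<lambda>\<^sub>p B r\<^sub>p\<close> too. For \<open>K x = \<lambda> B x\<close> the symmetry of \<open>K\<close> and \<open>B\<close> therefore gives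
  \<open>\<lambda>\<^sub>p (x \<bullet> B r\<^sub>p) = \<lambda> (x \<bullet> B r\<^sub>p)\<close>, so that only modes with \<open>\<lambda>\<^sub>p = \<lambda>\<close> occur in \<open>x\<close>.
\<close>

unbundle no inner_syntax

section \<open>Kronecker products of vectors\<close>

text \<open>
  The Kronecker product of two vectors, with the same index convention as for matrices: the
  index of the second factor varies fastest.
\<close>
definition vkron :: "real vec \<Rightarrow> real vec \<Rightarrow> real vec"  (infixl "\<otimes>\<^sub>v" 75) where
  "x \<otimes>\<^sub>v y = vec (dim_vec x * dim_vec y) (\<lambda>p. x $ (p div dim_vec y) * y $ (p mod dim_vec y))"

lemma dim_vkron [simp]: "dim_vec (x \<otimes>\<^sub>v y) = dim_vec x * dim_vec y"
  by (simp add: vkron_def)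

lemma dim_kron [simp]:
  "dim_row (A \<otimes>\<^sub>k B) = dim_row A * dim_row B" "dim_col (A \<otimes>\<^sub>k B) = dim_col A * dim_col B"
  by (simp_all add: kron_def)

lemma div_mod_less:
  fixes p :: nat
  assumes "p < m * n"
  shows "p div n < m" "p mod n < n"
  using assms
  by (auto simp: less_mult_imp_div_less) (metis mod_less_divisor mult_0_right not_gr0 not_less0)

lemma index_vkron:
  "p < dim_vec x * dim_vec y \<Longrightarrow> (x \<otimes>\<^sub>v y) $ p = x $ (p div dim_vec y) * y $ (p mod dim_vec y)"
  by (simp add: vkron_def)

lemma sum_div_mod:
  fixes f :: "nat \<Rightarrow> nat \<Rightarrow> 'a :: comm_monoid_add"
  shows "(\<Sum>p<m * n. f (p div n) (p mod n)) = (\<Sum>a<m. \<Sum>b<n. f a b)"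
proof -
  have "(\<Sum>p<m * n. f (p div n) (p mod n)) =
      (\<Sum>a<m. \<Sum>p = a * n..<a * n + n. f (p div n) (p mod n))"
    by (rule sum.nat_group [symmetric])
  also have "\<dots> = (\<Sum>a<m. \<Sum>b<n. f a b)"
  proof (rule sum.cong [OF refl])
    fix a
    have "(\<Sum>p = a * n..<a * n + n. f (p div n) (p mod n)) =
        (\<Sum>b = 0..<n. f ((b + a * n) div n) ((b + a * n) mod n))"
      using sum.shift_bounds_nat_ivl [of "\<lambda>p. f (p div n) (p mod n)" 0 "a * n" n]
      by (simp add: add.commute)
    also have "\<dots> = (\<Sum>b<n. f a b)"
      unfolding lessThan_atLeast0 by (rule sum.cong) auto
    finally show "(\<Sum>p = a * n..<a * n + n. f (p div n) (p mod n)) = (\<Sum>b<n. f a b)" .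
  qed
  finally show ?thesis .
qed

text \<open>
  The mixed-product rule. Every vector in the eigenvalue problem is expanded in Kronecker
  products, so this single rule evaluates all the blocks of both matrices.
\<close>
lemma kron_mult_vkron:
  assumes "dim_vec x = dim_col A" "dim_vec y = dim_col B"
  shows "(A \<otimes>\<^sub>k B) *\<^sub>v (x \<otimes>\<^sub>v y) = (A *\<^sub>v x) \<otimes>\<^sub>v (B *\<^sub>v y)"
proof (rule eq_vecI)
  fix p assume "p < dim_vec ((A *\<^sub>v x) \<otimes>\<^sub>v (B *\<^sub>v y))"
  then have p: "p < dim_row A * dim_row B" by simp
  let ?f = "\<lambda>c e. A $$ (p div dim_row B, c) * B $$ (p mod dim_row B, e) * (x $ c * y $ e)"
  have "((A \<otimes>\<^sub>k B) *\<^sub>v (x \<otimes>\<^sub>v y)) $ p =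
      (\<Sum>q<dim_col A * dim_col B. ?f (q div dim_col B) (q mod dim_col B))"
    using p assms by (simp add: scalar_prod_def kron_def vkron_def lessThan_atLeast0)
  also have "\<dots> = (\<Sum>c<dim_col A. \<Sum>e<dim_col B. ?f c e)"
    by (rule sum_div_mod)
  also have "\<dots> = ((A *\<^sub>v x) \<otimes>\<^sub>v (B *\<^sub>v y)) $ p"
    using p assms div_mod_less [OF p]
    by (simp add: vkron_def scalar_prod_def sum_product lessThan_atLeast0 ac_simps)
  finally show "((A \<otimes>\<^sub>k B) *\<^sub>v (x \<otimes>\<^sub>v y)) $ p = ((A *\<^sub>v x) \<otimes>\<^sub>v (B *\<^sub>v y)) $ p" .
qed simp

lemma scalar_prod_vkron:
  assumes "dim_vec x = dim_vec x'" "dim_vec y = dim_vec y'"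
  shows "(x \<otimes>\<^sub>v y) \<bullet> (x' \<otimes>\<^sub>v y') = (x \<bullet> x') * (y \<bullet> y')"
proof -
  let ?f = "\<lambda>c e. x $ c * y $ e * (x' $ c * y' $ e)"
  have "(x \<otimes>\<^sub>v y) \<bullet> (x' \<otimes>\<^sub>v y') =
      (\<Sum>q<dim_vec x' * dim_vec y'. ?f (q div dim_vec y') (q mod dim_vec y'))"
    using assms by (simp add: scalar_prod_def vkron_def lessThan_atLeast0)
  also have "\<dots> = (\<Sum>c<dim_vec x'. \<Sum>e<dim_vec y'. ?f c e)"
    by (rule sum_div_mod)
  also have "\<dots> = (x \<bullet> x') * (y \<bullet> y')"
    using assms by (simp add: scalar_prod_def sum_product lessThan_atLeast0 ac_simps)
  finally show ?thesis .
qed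

lemma smult_vkron_left: "(c \<cdot>\<^sub>v x) \<otimes>\<^sub>v y = c \<cdot>\<^sub>v (x \<otimes>\<^sub>v y)"
  by (rule eq_vecI) (auto simp: vkron_def div_mod_less)

lemma smult_vkron_right: "x \<otimes>\<^sub>v (c \<cdot>\<^sub>v y) = c \<cdot>\<^sub>v (x \<otimes>\<^sub>v y)"
  by (rule eq_vecI) (auto simp: vkron_def div_mod_less)

lemma zero_vkron: "0\<^sub>v m \<otimes>\<^sub>v y = 0\<^sub>v (m * dim_vec y)"
  by (rule eq_vecI) (auto simp: vkron_def div_mod_less)

lemma vkron_zero: "x \<otimes>\<^sub>v 0\<^sub>v m = 0\<^sub>v (dim_vec x * m)"
  by (rule eq_vecI) (auto simp: vkron_def div_mod_less)

text \<open>
  The one-dimensional factor \<open>unit_vec 1 0\<close> can be inserted at either end. The column \<open>e1\<close> then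
  acts on that factor.
\<close>
lemma vkron_one: "x \<otimes>\<^sub>v unit_vec 1 0 = x"
  by (rule eq_vecI) (auto simp: vkron_def)

lemma one_vkron: "unit_vec 1 0 \<otimes>\<^sub>v x = x"
  by (rule eq_vecI) (auto simp: vkron_def)

lemma transpose_kron: "transpose_mat (A \<otimes>\<^sub>k B) = transpose_mat A \<otimes>\<^sub>k transpose_mat B"
  by (rule eq_matI) (auto simp: kron_def div_mod_less)

lemma vec_mat_outer:
  "vec_mat (mat (dim_vec x) (dim_vec y) (\<lambda>(r, c). x $ r * y $ c)) = y \<otimes>\<^sub>v x"
proof (rule eq_vecI)
  fix p assume "p < dim_vec (y \<otimes>\<^sub>v x)"
  then have "p < dim_vec y * dim_vec x" by simp
  from this div_mod_less [OF this]
  show "vec_mat (mat (dim_vec x) (dim_vec y) (\<lambda>(r, c). x $ r * y $ c)) $ p = (y \<otimes>\<^sub>v x) $ p"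
    by (simp add: vec_mat_def vkron_def mult.commute)
qed (simp add: vec_mat_def mult.commute)

lemma unit_arr_eq_vkron:
  assumes "a < N - 1" "b < N - 1" "c < N - 1"
  shows "unit_arr N (Suc a) (Suc b) (Suc c) =
    unit_vec (N - 1) c \<otimes>\<^sub>v unit_vec (N - 1) b \<otimes>\<^sub>v unit_vec (N - 1) a"
proof (rule eq_vecI)
  define n where "n = N - 1"
  fix p assume "p < dim_vec (unit_vec (N - 1) c \<otimes>\<^sub>v unit_vec (N - 1) b \<otimes>\<^sub>v unit_vec (N - 1) a)"
  then have p: "p < n * n * n" by (simp add: n_def)
  note 1 = div_mod_less [OF p]
  note 2 = div_mod_less [OF 1(1)]
  have 3: "p div (n * n) = p div n div n" by (simp add: div_mult2_eq)
  have "unit_arr N (Suc a) (Suc b) (Suc c) $ p =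
      (if p mod n = a \<and> p div n mod n = b \<and> p div n div n = c then 1 else 0)"
    unfolding unit_arr_def vec_arr_def n_def [symmetric] using p by (simp add: 3)
  also have "\<dots> = unit_vec n c $ (p div n div n) * unit_vec n b $ (p div n mod n) *
      unit_vec n a $ (p mod n)"
    using 1(2) 2 by (auto simp: unit_vec_def)
  also have "\<dots> = (unit_vec n c \<otimes>\<^sub>v unit_vec n b \<otimes>\<^sub>v unit_vec n a) $ p"
    using p 1(1) by (simp only: index_vkron dim_vkron index_unit_vec(3))
  finally show "unit_arr N (Suc a) (Suc b) (Suc c) $ p =
      (unit_vec (N - 1) c \<otimes>\<^sub>v unit_vec (N - 1) b \<otimes>\<^sub>v unit_vec (N - 1) a) $ p"
    by (simp only: n_def)
qed (simp add: unit_arr_def vec_arr_def)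

section \<open>Positive definiteness of the Gram matrix\<close>

lemma degree_legendre: "degree (legendre n) = n"
proof -
  have "degree ([:-1, 0, 1 :: real:] ^ n) = 2 * n"
    by (simp add: degree_power_eq)
  then show ?thesis
    by (simp add: legendre_def degree_higher_pderiv)
qed

text \<open>The polynomial whose polynomial function is \<open>psi_Suc m\<close>.\<close>
definition psi_poly :: "nat \<Rightarrow> real poly" where
  "psi_poly m =
     Polynomial.smult (1 / sqrt (2 * (2 * real m + 1))) (legendre (m + 1) - legendre (m - 1))"

lemma poly_psi_poly: "poly (psi_poly m) x = psi_Suc m x"
  by (simp add: psi_poly_def psi_Suc_def)

lemma degree_psi_poly: "degree (psi_poly m) = m + 1"
proof -
  have "degree (legendre (m + 1) + - legendre (m - 1)) = m + 1"
    by (subst degree_add_eq_left) (auto simp: degree_legendre)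
  moreover have "sqrt (2 * (2 * real m + 1)) \<noteq> 0" by auto
  ultimately show ?thesis by (simp add: psi_poly_def)
qed

text \<open>
  The degrees of the \<open>psi_poly m\<close> are pairwise distinct, so these polynomials are linearly
  independent.
\<close>
lemma sum_psi_poly_eq_0:
  assumes "(\<Sum>r<n. Polynomial.smult (c r) (psi_poly (Suc r))) = 0" "r < n"
  shows "c r = 0"
  using assms
proof (induction n)
  case (Suc n)
  let ?S = "\<lambda>n. \<Sum>r<n. Polynomial.smult (c r) (psi_poly (Suc r))"
  have "Polynomial.coeff (Polynomial.smult (c r) (psi_poly (Suc r))) (n + 2) = 0" if "r < n" for r
    using that by (simp add: coeff_eq_0 degree_psi_poly)
  then have "(\<Sum>r<n. Polynomial.coeff (Polynomial.smult (c r) (psi_poly (Suc r))) (n + 2)) = 0"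
    by (intro sum.neutral ballI) (simp only: lessThan_iff)
  then have "Polynomial.coeff (?S n) (n + 2) = 0"
    by (simp only: coeff_sum)
  then have "c n * Polynomial.coeff (psi_poly (Suc n)) (n + 2) = 0"
    using arg_cong [OF Suc.prems(1), of "\<lambda>p. Polynomial.coeff p (n + 2)"] by simp
  moreover have "Polynomial.coeff (psi_poly (Suc n)) (n + 2) \<noteq> 0"
    using degree_psi_poly [of "Suc n"] leading_coeff_0_iff [of "psi_poly (Suc n)"] by auto
  ultimately have "c n = 0" by simp
  with Suc show ?case by (auto simp: less_Suc_eq)
qed simp

lemma dim_gram [simp]: "dim_row (gram N) = N - 1" "dim_col (gram N) = N - 1"
  by (simp_all add: gram_def)

lemma transpose_gram: "transpose_mat (gram N) = gram N"
  by (rule eq_matI) (auto simp: gram_def gram_entry_def mult.commute)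

text \<open>
  The quadratic form of the Gram matrix at \<open>x\<close> is the integral of the square of
  \<open>\<Sum>r. x $ r * psi_Suc (Suc r)\<close>, a polynomial that vanishes only for \<open>x = 0\<close>.
\<close>
lemma gram_pos_def:
  assumes x: "x \<in> carrier_vec (N - 1)" "x \<noteq> 0\<^sub>v (N - 1)"
  shows "x \<bullet> (gram N *\<^sub>v x) > 0"
proof -
  define n where "n = N - 1"
  define p where "p = (\<Sum>r<n. Polynomial.smult (x $ r) (psi_poly (Suc r)))"
  have x': "x \<in> carrier_vec n" "x \<noteq> 0\<^sub>v n" using x by (simp_all add: n_def)
  have psi: "continuous_on {-1..1} (psi_Suc m)" for m
  proof -
    have "psi_Suc m = poly (psi_poly m)" by (simp add: fun_eq_iff poly_psi_poly)
    then show ?thesis by (simp add: continuous_intros)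
  qed
  have "x \<bullet> (gram N *\<^sub>v x) = (\<Sum>r<n. \<Sum>c<n. x $ r * x $ c * gram_entry (Suc r) (Suc c))"
    using x' unfolding gram_def n_def [symmetric]
    by (simp add: scalar_prod_def lessThan_atLeast0 sum_distrib_left ac_simps)
  also have "\<dots> = integral {-1..1} (\<lambda>\<xi>. \<Sum>r<n. \<Sum>c<n.
      x $ r * x $ c * (psi_Suc (Suc c) \<xi> * psi_Suc (Suc r) \<xi>))"
    unfolding gram_entry_def
    by (intro integral_unique [symmetric] has_integral_sum finite_lessThan has_integral_mult_right
        integrable_integral integrable_continuous_interval continuous_on_mult psi)
  also have "(\<lambda>\<xi>. \<Sum>r<n. \<Sum>c<n. x $ r * x $ c * (psi_Suc (Suc c) \<xi> * psi_Suc (Suc r) \<xi>)) =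
      (\<lambda>\<xi>. poly p \<xi> * poly p \<xi>)"
    by (simp add: p_def poly_sum poly_psi_poly sum_product ac_simps)
  finally have eq: "x \<bullet> (gram N *\<^sub>v x) = integral {-1..1} (\<lambda>\<xi>. poly p \<xi> * poly p \<xi>)" .
  have cont: "continuous_on {-1..1} (\<lambda>\<xi>. poly p \<xi> * poly p \<xi>)"
    by (intro continuous_intros)
  have "p \<noteq> 0"
  proof
    assume "p = 0"
    then have "x $ r = 0" if "r < n" for r
      using sum_psi_poly_eq_0 [of "\<lambda>r. x $ r" n r] that by (simp add: p_def)
    with x' show False by (metis carrier_vecD eq_vecI index_zero_vec)
  qed
  have "integral {-1..1} (\<lambda>\<xi>. poly p \<xi> * poly p \<xi>) \<noteq> 0"
  proof
    assume "integral {-1..1} (\<lambda>\<xi>. poly p \<xi> * poly p \<xi>) = 0"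
    then have "\<forall>\<xi>\<in>{-1..1}. poly p \<xi> = 0"
      using integral_eq_0_iff [OF cont] by auto
    then have "{-1..1} \<subseteq> {\<xi>. poly p \<xi> = 0}" by auto
    then have "finite {-1..1 :: real}"
      using poly_roots_finite [OF \<open>p \<noteq> 0\<close>] finite_subset by blast
    then show False using infinite_Icc [of "-1 :: real" 1] by simp
  qed
  moreover have "integral {-1..1} (\<lambda>\<xi>. poly p \<xi> * poly p \<xi>) \<ge> 0"
    by (rule integral_nonneg) (auto intro: integrable_continuous_interval cont)
  ultimately show ?thesis unfolding eq by simp
qed

section \<open>Block structure and symmetry\<close>

lemma append_vec_assoc: "(u @\<^sub>v v) @\<^sub>v w = u @\<^sub>v (v @\<^sub>v w)"
  by (rule eq_vecI) (auto simp: less_diff_conv2)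

lemma block3_mult_stack:
  assumes [simp]:
    "A \<in> carrier_mat l l" "B \<in> carrier_mat l l" "C \<in> carrier_mat l l"
    "D \<in> carrier_mat l l" "E \<in> carrier_mat l l" "F \<in> carrier_mat l l"
    "G \<in> carrier_mat l l" "H \<in> carrier_mat l l" "K \<in> carrier_mat l l"
    and uvw [simp]: "u \<in> carrier_vec l" "v \<in> carrier_vec l" "w \<in> carrier_vec l"
  shows "block3 A B C D E F G H K *\<^sub>v stack (u, v, w) =
    stack (A *\<^sub>v u + B *\<^sub>v v + C *\<^sub>v w, D *\<^sub>v u + E *\<^sub>v v + F *\<^sub>v w, G *\<^sub>v u + H *\<^sub>v v + K *\<^sub>v w)"
proof -
  have [simp]: "dim_col G = l" "dim_col H = l" by (rule carrier_matD, fact assms)+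
  have 1: "four_block_mat A B D E *\<^sub>v (u @\<^sub>v v) = (A *\<^sub>v u + B *\<^sub>v v) @\<^sub>v (D *\<^sub>v u + E *\<^sub>v v)"
    by (rule four_block_mat_mult_vec; fact assms)
  have 2: "(C @\<^sub>r F) *\<^sub>v w = (C *\<^sub>v w) @\<^sub>v (F *\<^sub>v w)"
    by (rule mat_mult_append; fact assms)
  have "four_block_mat G H (0\<^sub>m 0 l) (0\<^sub>m 0 l) *\<^sub>v (u @\<^sub>v v) =
      (G *\<^sub>v u + H *\<^sub>v v) @\<^sub>v (0\<^sub>m 0 l *\<^sub>v u + 0\<^sub>m 0 l *\<^sub>v v)"
    by (rule four_block_mat_mult_vec
        [where ?nr1.0 = l and ?nr2.0 = 0 and ?nc1.0 = l and ?nc2.0 = l]) simp_all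
  also have "\<dots> = G *\<^sub>v u + H *\<^sub>v v"
    by (rule eq_vecI) auto
  finally have 3: "four_block_mat G H (0\<^sub>m 0 l) (0\<^sub>m 0 l) *\<^sub>v (u @\<^sub>v v) = G *\<^sub>v u + H *\<^sub>v v" .
  have c1: "four_block_mat A B D E \<in> carrier_mat (l + l) (l + l)"
    by (rule four_block_carrier_mat; fact assms)
  have c2: "C @\<^sub>r F \<in> carrier_mat (l + l) l"
    by (rule carrier_append_rows; fact assms)
  have c3: "four_block_mat G H (0\<^sub>m 0 l) (0\<^sub>m 0 l) \<in> carrier_mat l (l + l)"
    using four_block_carrier_mat [OF assms(7), of "0\<^sub>m 0 l" 0 l] by simp
  have "block3 A B C D E F G H K *\<^sub>v ((u @\<^sub>v v) @\<^sub>v w) =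
    (four_block_mat A B D E *\<^sub>v (u @\<^sub>v v) + (C @\<^sub>r F) *\<^sub>v w) @\<^sub>v
    (four_block_mat G H (0\<^sub>m 0 l) (0\<^sub>m 0 l) *\<^sub>v (u @\<^sub>v v) + K *\<^sub>v w)"
    unfolding block3_def \<open>dim_col G = l\<close> \<open>dim_col H = l\<close>
    by (rule four_block_mat_mult_vec
        [OF c1 c2 c3 assms(9) append_carrier_vec [OF assms(10,11)] assms(12)])
  also have "four_block_mat A B D E *\<^sub>v (u @\<^sub>v v) + (C @\<^sub>r F) *\<^sub>v w =
      (A *\<^sub>v u + B *\<^sub>v v + C *\<^sub>v w) @\<^sub>v (D *\<^sub>v u + E *\<^sub>v v + F *\<^sub>v w)"
    unfolding 1 2
    by (rule append_vec_add [where n = l and m = l];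
        intro add_carrier_vec mult_mat_vec_carrier [where n = l] assms)
  finally show ?thesis
    unfolding 3 by (simp only: append_vec_assoc stack.simps)
qed

lemma scalar_prod_stack:
  assumes "u \<in> carrier_vec l" "v \<in> carrier_vec l" "w \<in> carrier_vec l"
    "u' \<in> carrier_vec l" "v' \<in> carrier_vec l" "w' \<in> carrier_vec l"
  shows "stack (u, v, w) \<bullet> stack (u', v', w') = u \<bullet> u' + v \<bullet> v' + w \<bullet> w'"
proof -
  have "stack (u, v, w) \<bullet> stack (u', v', w') = u \<bullet> u' + (v @\<^sub>v w) \<bullet> (v' @\<^sub>v w')"
    unfolding stack.simps using assms
    by (intro scalar_prod_append [where ?n1.0 = l and ?n2.0 = "l + l"]) simp_all
  also have "(v @\<^sub>v w) \<bullet> (v' @\<^sub>v w') = v \<bullet> v' + w \<bullet> w'"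
    using assms by (intro scalar_prod_append)
  finally show ?thesis by simp
qed

lemma stack_carrier:
  assumes "u \<in> carrier_vec l" "v \<in> carrier_vec l" "w \<in> carrier_vec l"
  shows "stack (u, v, w) \<in> carrier_vec (3 * l)"
  using append_carrier_vec [OF assms(1) append_carrier_vec [OF assms(2,3)]]
  by (simp add: numeral_3_eq_3 add.assoc)

lemma stack_smult: "stack (c \<cdot>\<^sub>v u, c \<cdot>\<^sub>v v, c \<cdot>\<^sub>v w) = c \<cdot>\<^sub>v stack (u, v, w)"
  by (rule eq_vecI) auto

lemma stack_cases:
  assumes "x \<in> carrier_vec (3 * l)"
  obtains u v w where "u \<in> carrier_vec l" "v \<in> carrier_vec l" "w \<in> carrier_vec l"
    "x = stack (u, v, w)"
proof
  let ?v = "\<lambda>s. vec l (\<lambda>i. x $ (s + i))"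
  show "x = stack (?v 0, ?v l, ?v (l + l))"
    using assms by (intro eq_vecI) auto
qed auto

lemma block3_scalar_prod_sym:
  assumes A: "A \<in> carrier_mat l l" "transpose_mat A = A"
    and E: "E \<in> carrier_mat l l" "transpose_mat E = E"
    and K: "K \<in> carrier_mat l l" "transpose_mat K = K"
    and B: "B \<in> carrier_mat l l" and C: "C \<in> carrier_mat l l" and F: "F \<in> carrier_mat l l"
    and x: "x \<in> carrier_vec (3 * l)" and y: "y \<in> carrier_vec (3 * l)"
  shows "(block3 A B C (transpose_mat B) E F (transpose_mat C) (transpose_mat F) K *\<^sub>v x) \<bullet> y =
    x \<bullet> (block3 A B C (transpose_mat B) E F (transpose_mat C) (transpose_mat F) K *\<^sub>v y)"
proof -
  obtain u v w where u: "u \<in> carrier_vec l" and v: "v \<in> carrier_vec l" and w: "w \<in> carrier_vec l"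
    and x_eq: "x = stack (u, v, w)" using x by (rule stack_cases)
  obtain u' v' w' where u': "u' \<in> carrier_vec l" and v': "v' \<in> carrier_vec l"
    and w': "w' \<in> carrier_vec l" and y_eq: "y = stack (u', v', w')" using y by (rule stack_cases)
  note car = A(1) E(1) K(1) B C F u v w u' v' w'
  have sym: "(M *\<^sub>v a) \<bullet> b = a \<bullet> (transpose_mat M *\<^sub>v b)"
    if "M \<in> carrier_mat l l" "a \<in> carrier_vec l" "b \<in> carrier_vec l" for M :: "real mat" and a b
    using transpose_vec_mult_scalar [of "transpose_mat M" l l b a] that by simp

  let ?K = "block3 A B C (transpose_mat B) E F (transpose_mat C) (transpose_mat F) K"
  have T: "transpose_mat B \<in> carrier_mat l l" "transpose_mat C \<in> carrier_mat l l"
    "transpose_mat F \<in> carrier_mat l l"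
    using B C F by simp_all
  note mc = mult_mat_vec_carrier [where n = l and nr = l]
  have expand: "?K *\<^sub>v stack (a, b, c) =
      stack (A *\<^sub>v a + B *\<^sub>v b + C *\<^sub>v c, transpose_mat B *\<^sub>v a + E *\<^sub>v b + F *\<^sub>v c,
        transpose_mat C *\<^sub>v a + transpose_mat F *\<^sub>v b + K *\<^sub>v c)"
    if "a \<in> carrier_vec l" "b \<in> carrier_vec l" "c \<in> carrier_vec l" for a b c
    by (rule block3_mult_stack; fact that car T)
  have dist: "(a + b + c) \<bullet> z = a \<bullet> z + b \<bullet> z + c \<bullet> z"
    "z \<bullet> (a + b + c) = z \<bullet> a + z \<bullet> b + z \<bullet> c"
    if "a \<in> carrier_vec l" "b \<in> carrier_vec l" "c \<in> carrier_vec l" "z \<in> carrier_vec l"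
    for a b c z :: "real vec"
    using that by (simp_all add: add_scalar_prod_distrib [of _ l] scalar_prod_add_distrib [of _ l])
  have "(?K *\<^sub>v x) \<bullet> y =
      (A *\<^sub>v u + B *\<^sub>v v + C *\<^sub>v w) \<bullet> u' +
      (transpose_mat B *\<^sub>v u + E *\<^sub>v v + F *\<^sub>v w) \<bullet> v' +
      (transpose_mat C *\<^sub>v u + transpose_mat F *\<^sub>v v + K *\<^sub>v w) \<bullet> w'"
    unfolding x_eq y_eq expand [OF u v w]
    by (rule scalar_prod_stack [where l = l]; (intro add_carrier_vec mc)?; fact car T)
  also have "\<dots> = u \<bullet> (A *\<^sub>v u') + v \<bullet> (transpose_mat B *\<^sub>v u') + w \<bullet> (transpose_mat C *\<^sub>v u') +
      (u \<bullet> (B *\<^sub>v v') + v \<bullet> (E *\<^sub>v v') + w \<bullet> (transpose_mat F *\<^sub>v v')) +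
      (u \<bullet> (C *\<^sub>v w') + v \<bullet> (F *\<^sub>v w') + w \<bullet> (K *\<^sub>v w'))"
    by (simp only: dist mc car T sym A(2) E(2) K(2) transpose_transpose)
  also have "\<dots> = u \<bullet> (A *\<^sub>v u' + B *\<^sub>v v' + C *\<^sub>v w') +
      v \<bullet> (transpose_mat B *\<^sub>v u' + E *\<^sub>v v' + F *\<^sub>v w') +
      w \<bullet> (transpose_mat C *\<^sub>v u' + transpose_mat F *\<^sub>v v' + K *\<^sub>v w')"
    by (simp only: dist mc car T ac_simps)
  also have "\<dots> = x \<bullet> (?K *\<^sub>v y)"
    unfolding x_eq y_eq expand [OF u' v' w']
    by (rule scalar_prod_stack [where l = l, symmetric]; (intro add_carrier_vec mc)?; fact car T)
  finally show ?thesis .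
qed

lemma dim_Emat [simp]: "dim_row (Emat N) = N - 1" "dim_col (Emat N) = N"
  by (simp_all add: Emat_def)

lemma dim_e1 [simp]: "dim_row (e1 N) = N" "dim_col (e1 N) = 1"
  by (simp_all add: e1_def)

lemma len_eq:
  "N * (N - 1) * (N - 1) = len N" "(N - 1) * N * (N - 1) = len N" "(N - 1) * (N - 1) * N = len N"
  by (simp_all add: len_def)

lemma carrier_blocks [simp]:
  "A11 N \<in> carrier_mat (len N) (len N)" "A12 N \<in> carrier_mat (len N) (len N)"
  "A13 N \<in> carrier_mat (len N) (len N)" "A22 N \<in> carrier_mat (len N) (len N)"
  "A23 N \<in> carrier_mat (len N) (len N)" "A33 N \<in> carrier_mat (len N) (len N)"
  "A1 N \<in> carrier_mat (len N) (len N)" "A2 N \<in> carrier_mat (len N) (len N)"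
  "A3 N \<in> carrier_mat (len N) (len N)"
  unfolding carrier_mat_def
  by (simp_all add: A11_def A12_def A13_def A22_def A23_def A33_def A1_def A2_def A3_def len_def)

lemma carrier_blocks_transpose [simp]:
  "A21 N \<in> carrier_mat (len N) (len N)" "A31 N \<in> carrier_mat (len N) (len N)"
  "A32 N \<in> carrier_mat (len N) (len N)"
  by (simp_all add: A21_def A31_def A32_def)

lemma transpose_blocks:
  "transpose_mat (A11 N) = A11 N" "transpose_mat (A22 N) = A22 N" "transpose_mat (A33 N) = A33 N"
  "transpose_mat (A1 N) = A1 N" "transpose_mat (A2 N) = A2 N" "transpose_mat (A3 N) = A3 N"
proof -
  have add: "transpose_mat (A + B) = transpose_mat A + transpose_mat B"
    if "dim_row A = dim_row B" "dim_col A = dim_col B" for A B :: "real mat"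
    using that by (intro eq_matI) auto
  show "transpose_mat (A11 N) = A11 N" "transpose_mat (A22 N) = A22 N" "transpose_mat (A33 N) = A33 N"
    "transpose_mat (A1 N) = A1 N" "transpose_mat (A2 N) = A2 N" "transpose_mat (A3 N) = A3 N"
    by (simp_all add: A11_def A22_def A33_def A1_def A2_def A3_def add transpose_kron transpose_gram)
qed

lemma stiffness_sym:
  assumes "x \<in> carrier_vec (3 * len N)" "y \<in> carrier_vec (3 * len N)"
  shows "(stiffness N *\<^sub>v x) \<bullet> y = x \<bullet> (stiffness N *\<^sub>v y)"
  unfolding stiffness_def A21_def A31_def A32_def
  by (rule block3_scalar_prod_sym [where l = "len N"]) (simp_all add: assms transpose_blocks)

lemma mass_sym:
  assumes "x \<in> carrier_vec (3 * len N)" "y \<in> carrier_vec (3 * len N)"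
  shows "(mass N *\<^sub>v x) \<bullet> y = x \<bullet> (mass N *\<^sub>v y)"
proof -
  let ?Z = "0\<^sub>m (len N) (len N) :: real mat"
  have "mass N = block3 (A1 N) ?Z ?Z (transpose_mat ?Z) (A2 N) ?Z
      (transpose_mat ?Z) (transpose_mat ?Z) (A3 N)"
    by (simp add: mass_def Let_def)
  then show ?thesis
    using block3_scalar_prod_sym [of "A1 N" "len N" "A2 N" "A3 N" ?Z ?Z ?Z x y] assms
    by (simp add: transpose_blocks)
qed

lemma stiffness_mult_stack:
  assumes "u \<in> carrier_vec (len N)" "v \<in> carrier_vec (len N)" "w \<in> carrier_vec (len N)"
  shows "stiffness N *\<^sub>v stack (u, v, w) =
    stack (A11 N *\<^sub>v u + A12 N *\<^sub>v v + A13 N *\<^sub>v w,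
           A21 N *\<^sub>v u + A22 N *\<^sub>v v + A23 N *\<^sub>v w,
           A31 N *\<^sub>v u + A32 N *\<^sub>v v + A33 N *\<^sub>v w)"
  unfolding stiffness_def by (rule block3_mult_stack [where l = "len N"]) (simp_all add: assms)

lemma zero_mult_mat_vec: "v \<in> carrier_vec n \<Longrightarrow> 0\<^sub>m m n *\<^sub>v v = (0\<^sub>v m :: real vec)"
  by (rule eq_vecI) auto

lemma mass_mult_stack:
  assumes "u \<in> carrier_vec (len N)" "v \<in> carrier_vec (len N)" "w \<in> carrier_vec (len N)"
  shows "mass N *\<^sub>v stack (u, v, w) = stack (A1 N *\<^sub>v u, A2 N *\<^sub>v v, A3 N *\<^sub>v w)"
proof -
  have c: "A1 N *\<^sub>v u \<in> carrier_vec (len N)" "A2 N *\<^sub>v v \<in> carrier_vec (len N)"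
    "A3 N *\<^sub>v w \<in> carrier_vec (len N)"
    using assms by (simp_all add: mult_mat_vec_carrier [where n = "len N"])
  have "mass N *\<^sub>v stack (u, v, w) =
    stack (A1 N *\<^sub>v u + 0\<^sub>m (len N) (len N) *\<^sub>v v + 0\<^sub>m (len N) (len N) *\<^sub>v w,
           0\<^sub>m (len N) (len N) *\<^sub>v u + A2 N *\<^sub>v v + 0\<^sub>m (len N) (len N) *\<^sub>v w,
           0\<^sub>m (len N) (len N) *\<^sub>v u + 0\<^sub>m (len N) (len N) *\<^sub>v v + A3 N *\<^sub>v w)"
    unfolding mass_def Let_def by (rule block3_mult_stack [where l = "len N"]) (simp_all add: assms)
  then show ?thesis using assms c by (simp add: zero_mult_mat_vec del: stack.simps)
qed

lemma Emat_mult_vCons: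
  assumes "x \<in> carrier_vec n"
  shows "Emat (Suc n) *\<^sub>v vCons a x = x"
proof (rule eq_vecI)
  fix r assume "r < dim_vec x"
  with assms have r: "r < n" by simp
  have "(Emat (Suc n) *\<^sub>v vCons a x) $ r = (\<Sum>c<Suc n. (if Suc r = c then vCons a x $ c else 0))"
    using r assms
    by (simp add: scalar_prod_def Emat_def lessThan_atLeast0 if_distrib [of "\<lambda>z. z * _"]
        cong: if_cong del: sum.op_ivl_Suc)
  also have "\<dots> = x $ r"
    using r assms by (simp del: sum.lessThan_Suc)
  finally show "(Emat (Suc n) *\<^sub>v vCons a x) $ r = x $ r" .
qed (use assms in simp)

lemma transpose_Emat_mult:
  assumes "x \<in> carrier_vec n"
  shows "transpose_mat (Emat (Suc n)) *\<^sub>v x = vCons 0 x"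
proof (rule eq_vecI)
  fix r assume "r < dim_vec (vCons 0 x)"
  with assms have r: "r < Suc n" by simp
  have "(transpose_mat (Emat (Suc n)) *\<^sub>v x) $ r = (\<Sum>c<n. (if Suc c = r then x $ c else 0))"
    using r assms
    by (auto simp: scalar_prod_def Emat_def lessThan_atLeast0 intro!: sum.cong)
  also have "\<dots> = vCons 0 x $ r"
  proof (cases r)
    case (Suc s)
    then have "(\<Sum>c<n. (if Suc c = r then x $ c else 0)) = (\<Sum>c<n. (if c = s then x $ c else 0))"
      by simp
    then show ?thesis using r assms Suc by simp
  qed simp
  finally show "(transpose_mat (Emat (Suc n)) *\<^sub>v x) $ r = vCons 0 x $ r" .
qed (use assms in simp)

lemma e1_mult: "e1 (Suc n) *\<^sub>v unit_vec 1 0 = vCons 1 (0\<^sub>v n)"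
  by (rule eq_vecI) (auto simp: e1_def scalar_prod_def vec_index_vCons)

lemma transpose_uminus_mat: "transpose_mat (- A) = - transpose_mat A"
  by (rule eq_matI) auto

lemma mult_mat_smult_vec:
  assumes "dim_vec v = dim_col M"
  shows "M *\<^sub>v (s \<cdot>\<^sub>v v) = s \<cdot>\<^sub>v (M *\<^sub>v v :: real vec)"
  by (rule mult_mat_vec [where nr = "dim_row M" and nc = "dim_col M"])
    (use assms in \<open>auto intro: carrier_matI carrier_vecI\<close>)

lemma mult_mat_zero_vec: "dim_col M = l \<Longrightarrow> M *\<^sub>v 0\<^sub>v l = (0\<^sub>v (dim_row M) :: real vec)"
  by (intro eq_vecI) (auto simp: scalar_prod_def)

lemma uminus_smult_vec: "- (c \<cdot>\<^sub>v v) = (- c) \<cdot>\<^sub>v (v :: real vec)"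
  by (rule eq_vecI) auto

section \<open>Product bases diagonalizing the blocks\<close>

text \<open>
  An orthogonal diagonalization of the Gram matrix of size \<open>n = N - 1\<close>. Since \<open>Q\<close> is square,
  \<open>Q\<^sup>T Q = I\<close> expresses its orthogonality. That \<open>d 1, \<dots>, d n\<close> are positive is a consequence
  (\<open>d_pos\<close>).
\<close>

locale gram_diagonalization =
  fixes n :: nat and Q :: "real mat" and d :: "nat \<Rightarrow> real"
  assumes Q: "Q \<in> carrier_mat n n"
    and QtQ: "transpose_mat Q * Q = 1\<^sub>m n"
    and gram_eq: "gram (Suc n) = Q * mat_diag n (\<lambda>r. d (Suc r)) * transpose_mat Q"
begin

abbreviation N where "N \<equiv> Suc n"

text \<open>
  The eigenvectors \<open>q 1, \<dots>, q n\<close> of the Gram matrix. With \<open>q 0 = 0\<close> the identity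
  \<open>E h\<^sub>i = q\<^sub>i\<close> (see \<open>h\<close>) and the eigenvalue equation also hold at the index 0.
\<close>
definition q :: "nat \<Rightarrow> real vec" where
  "q i = (if i = 0 then 0\<^sub>v n else col Q (i - 1))"

text \<open>
  The orthonormal basis \<open>e\<^sub>1, E\<^sup>T q\<^sub>1, \<dots>, E\<^sup>T q\<^sub>n\<close> of the space of dimension \<open>N\<close>, numbered from 0:
  \<open>E\<^sup>T\<close> prepends an entry 0.
\<close>
definition h :: "nat \<Rightarrow> real vec" where
  "h i = vCons (of_bool (i = 0)) (q i)"

lemma dim_q [simp]: "dim_vec (q i) = n"
  using Q by (auto simp: q_def)

lemma q_carrier [simp]: "q i \<in> carrier_vec n"
  by (rule carrier_vecI) simp

lemma dim_h [simp]: "dim_vec (h i) = N"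
  by (simp add: h_def)

lemma h_carrier [simp]: "h i \<in> carrier_vec N"
  by (rule carrier_vecI) simp

lemma q_0 [simp]: "q 0 = 0\<^sub>v n"
  by (simp add: q_def)

lemma scalar_prod_q:
  assumes "i \<le> n" "j \<le> n"
  shows "q i \<bullet> q j = of_bool (i = j \<and> i \<noteq> 0)"
proof (cases "i = 0 \<or> j = 0")
  case True
  then show ?thesis
    using scalar_prod_left_zero [OF q_carrier] scalar_prod_right_zero [OF q_carrier] by auto
next
  case False
  with assms have ij: "i - 1 < n" "j - 1 < n" by auto
  have "q i \<bullet> q j = (transpose_mat Q * Q) $$ (i - 1, j - 1)"
    using False ij Q by (simp add: q_def)
  also have "\<dots> = of_bool (i = j \<and> i \<noteq> 0)"
    unfolding QtQ using False ij by auto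
  finally show ?thesis .
qed

lemma scalar_prod_h:
  assumes "i \<le> n" "j \<le> n"
  shows "h i \<bullet> h j = of_bool (i = j)"
  using assms by (auto simp: h_def scalar_prod_q)

lemma gram_mult_q:
  assumes "i \<le> n"
  shows "gram N *\<^sub>v q i = d i \<cdot>\<^sub>v q i"
proof (cases i)
  case 0
  then show ?thesis by (intro eq_vecI) (simp_all add: scalar_prod_def)
next
  case (Suc r)
  with assms have r: "r < n" by simp
  let ?D = "mat_diag n (\<lambda>r. d (Suc r))"
  have D: "?D \<in> carrier_mat n n" and Qt: "transpose_mat Q \<in> carrier_mat n n"
    using Q by simp_all
  have "gram N * Q = Q * ?D * (transpose_mat Q * Q)"
    unfolding gram_eq by (rule assoc_mult_mat [of _ n n _ n _ n]) (use Q D Qt in auto)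
  also have "\<dots> = Q * ?D"
    unfolding QtQ by (rule right_mult_one_mat [of _ n]) (use mult_carrier_mat [OF Q D] in simp)
  finally have GQ: "gram N * Q = Q * ?D" .
  have "gram N *\<^sub>v col Q r = col (gram N * Q) r"
    by (rule col_mult2 [symmetric]) (use Q r in \<open>auto intro: carrier_matI\<close>)
  also have "\<dots> = d (Suc r) \<cdot>\<^sub>v col Q r"
    unfolding GQ mat_diag_mult_right [OF Q] using r Q by (intro eq_vecI) auto
  finally show ?thesis by (simp add: q_def Suc)
qed

lemma d_pos:
  assumes "i \<in> {1..n}"
  shows "d i > 0"
proof -
  have qq: "q i \<bullet> q i = 1" using assms by (subst scalar_prod_q) auto
  then have "q i \<noteq> 0\<^sub>v n" by auto
  then have "q i \<bullet> (gram N *\<^sub>v q i) > 0" by (intro gram_pos_def) simp_all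
  also have "q i \<bullet> (gram N *\<^sub>v q i) = d i"
    using assms by (simp add: gram_mult_q qq)
  finally show ?thesis .
qed

lemma Emat_h: "Emat N *\<^sub>v h i = q i"
  by (simp add: h_def Emat_mult_vCons)

lemma transpose_Emat_q: "i \<noteq> 0 \<Longrightarrow> transpose_mat (Emat N) *\<^sub>v q i = h i"
  by (simp add: h_def transpose_Emat_mult)

lemma e1_mult_h: "e1 N *\<^sub>v unit_vec 1 0 = h 0"
  by (simp add: h_def e1_mult del: One_nat_def)

text \<open>
  The product bases of the spaces of the three components \<open>u\<close>, \<open>v\<close>, \<open>w\<close>. The index \<open>i\<close> belongs
  to the first (fastest) array index and is allowed to be 0 in \<open>F1\<close>; likewise \<open>j\<close> in \<open>F2\<close> and
  \<open>k\<close> in \<open>F3\<close>. At an index 0 in any other position the vector is zero.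
\<close>
definition F1 :: "nat \<Rightarrow> nat \<Rightarrow> nat \<Rightarrow> real vec" where
  "F1 i j k = q k \<otimes>\<^sub>v q j \<otimes>\<^sub>v h i"

definition F2 :: "nat \<Rightarrow> nat \<Rightarrow> nat \<Rightarrow> real vec" where
  "F2 i j k = q k \<otimes>\<^sub>v h j \<otimes>\<^sub>v q i"

definition F3 :: "nat \<Rightarrow> nat \<Rightarrow> nat \<Rightarrow> real vec" where
  "F3 i j k = h k \<otimes>\<^sub>v q j \<otimes>\<^sub>v q i"

lemma F_carrier [simp]:
  "F1 i j k \<in> carrier_vec (len N)" "F2 i j k \<in> carrier_vec (len N)" "F3 i j k \<in> carrier_vec (len N)"
  by (auto intro!: carrier_vecI simp: F1_def F2_def F3_def len_def algebra_simps)

lemma F_eq_0: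
  "j = 0 \<or> k = 0 \<Longrightarrow> F1 i j k = 0\<^sub>v (len N)"
  "i = 0 \<or> k = 0 \<Longrightarrow> F2 i j k = 0\<^sub>v (len N)"
  "i = 0 \<or> j = 0 \<Longrightarrow> F3 i j k = 0\<^sub>v (len N)"
  by (auto simp: F1_def F2_def F3_def zero_vkron vkron_zero len_def)
    (simp_all add: algebra_simps)

lemma scalar_prod_F:
  assumes "i \<le> n" "j \<le> n" "k \<le> n" "i' \<le> n" "j' \<le> n" "k' \<le> n"
  shows "F1 i j k \<bullet> F1 i' j' k' = of_bool ((i, j, k) = (i', j', k') \<and> j \<noteq> 0 \<and> k \<noteq> 0)"
    "F2 i j k \<bullet> F2 i' j' k' = of_bool ((i, j, k) = (i', j', k') \<and> i \<noteq> 0 \<and> k \<noteq> 0)"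
    "F3 i j k \<bullet> F3 i' j' k' = of_bool ((i, j, k) = (i', j', k') \<and> i \<noteq> 0 \<and> j \<noteq> 0)"
  using assms by (auto simp: F1_def F2_def F3_def scalar_prod_vkron scalar_prod_q scalar_prod_h)

lemmas kron_simps = kron_mult_vkron smult_vkron_left smult_vkron_right smult_smult_assoc
  one_mult_mat_vec [OF q_carrier] one_mult_mat_vec [OF h_carrier]
  Emat_h transpose_Emat_q gram_mult_q

context
  fixes i j k :: nat
  assumes le: "i \<le> n" "j \<le> n" "k \<le> n"
begin

lemma mass_blocks_F:
  "A1 N *\<^sub>v F1 i j k = (d j * d k) \<cdot>\<^sub>v F1 i j k"
  "A2 N *\<^sub>v F2 i j k = (d i * d k) \<cdot>\<^sub>v F2 i j k"
  "A3 N *\<^sub>v F3 i j k = (d i * d j) \<cdot>\<^sub>v F3 i j k"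
  using le by (simp_all add: A1_def A2_def A3_def F1_def F2_def F3_def kron_simps mult.commute)

lemma diagonal_blocks_F:
  "A11 N *\<^sub>v F1 i j k = (d j + d k) \<cdot>\<^sub>v F1 i j k"
  "A22 N *\<^sub>v F2 i j k = (d i + d k) \<cdot>\<^sub>v F2 i j k"
  "A33 N *\<^sub>v F3 i j k = (d i + d j) \<cdot>\<^sub>v F3 i j k"
proof -
  have add: "(A + B) *\<^sub>v x = A *\<^sub>v x + B *\<^sub>v x"
    if "dim_row A = dim_row B" "dim_col A = dim_col B" "dim_vec x = dim_col B"
    for A B and x :: "real vec"
    by (rule add_mult_distrib_mat_vec [where nr = "dim_row A" and nc = "dim_col A"])
      (use that in \<open>auto intro: carrier_matI carrier_vecI\<close>)
  show "A11 N *\<^sub>v F1 i j k = (d j + d k) \<cdot>\<^sub>v F1 i j k"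
    "A22 N *\<^sub>v F2 i j k = (d i + d k) \<cdot>\<^sub>v F2 i j k"
    "A33 N *\<^sub>v F3 i j k = (d i + d j) \<cdot>\<^sub>v F3 i j k"
    using le by (simp_all add: A11_def A22_def A33_def F1_def F2_def F3_def kron_simps add
        add_smult_distrib_vec)
qed

text \<open>
  The index 0 has to be excluded where \<open>E\<^sup>T\<close> acts on \<open>q 0 = 0\<close>, since \<open>h 0\<close> is not zero. In the
  modes the coefficient in question is zero whenever that index is.
\<close>
lemma upper_blocks_F:
  "i \<noteq> 0 \<Longrightarrow> A12 N *\<^sub>v F2 i j k = (- d k) \<cdot>\<^sub>v F1 i j k"
  "i \<noteq> 0 \<Longrightarrow> A13 N *\<^sub>v F3 i j k = (- d j) \<cdot>\<^sub>v F1 i j k"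
  "j \<noteq> 0 \<Longrightarrow> A23 N *\<^sub>v F3 i j k = (- d i) \<cdot>\<^sub>v F2 i j k"
  using le by (simp_all add: A12_def A13_def A23_def F1_def F2_def F3_def kron_simps uminus_smult_vec)

lemma lower_blocks_F:
  "j \<noteq> 0 \<Longrightarrow> A21 N *\<^sub>v F1 i j k = (- d k) \<cdot>\<^sub>v F2 i j k"
  "k \<noteq> 0 \<Longrightarrow> A31 N *\<^sub>v F1 i j k = (- d j) \<cdot>\<^sub>v F3 i j k"
  "k \<noteq> 0 \<Longrightarrow> A32 N *\<^sub>v F2 i j k = (- d i) \<cdot>\<^sub>v F3 i j k"
  using le
  by (simp_all add: A21_def A31_def A32_def A12_def A13_def A23_def transpose_uminus_mat
      transpose_kron transpose_gram F1_def F2_def F3_def kron_simps uminus_smult_vec)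

end

end

section \<open>Biorthogonal families\<close>

lemma (in vec_space) lincomb_scalar_prod:
  assumes "X \<subseteq> carrier_vec n" "w \<in> carrier_vec n"
  shows "lincomb a X \<bullet> w = (\<Sum>v\<in>X. a v * (v \<bullet> w))"
proof -
  have "lincomb a X \<bullet> w = (\<Sum>v\<in>X. (a v \<cdot>\<^sub>v v) \<bullet> w)"
    unfolding lincomb_def using assms by (intro finsum_scalar_prod_sum) auto
  also have "\<dots> = (\<Sum>v\<in>X. a v * (v \<bullet> w))"
    using assms by (intro sum.cong refl scalar_prod_smult_left) auto
  finally show ?thesis .
qed

text \<open>
  A finite family \<open>f\<close> together with a dual family \<open>g\<close>, not normalized. Such an \<open>f\<close> is linearly
  independent, and the scalar product with \<open>g q\<close> detects the coefficient of \<open>f q\<close>.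
\<close>
locale biorthogonal =
  fixes m :: nat and T :: "'i set" and f g :: "'i \<Rightarrow> real vec"
  assumes fin: "finite T"
    and f: "\<And>p. p \<in> T \<Longrightarrow> f p \<in> carrier_vec m"
    and g: "\<And>p. p \<in> T \<Longrightarrow> g p \<in> carrier_vec m"
    and off_diagonal: "\<And>p q. p \<in> T \<Longrightarrow> q \<in> T \<Longrightarrow> p \<noteq> q \<Longrightarrow> f p \<bullet> g q = 0"
    and diagonal: "\<And>p. p \<in> T \<Longrightarrow> f p \<bullet> g p \<noteq> 0"
begin

interpretation V: vec_space "TYPE(real)" m .

lemma inj_on_f: "inj_on f T"
proof (rule inj_onI)
  fix p q assume "p \<in> T" "q \<in> T" "f p = f q"
  then show "p = q" using off_diagonal [of p q] diagonal [of q] by metis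
qed

lemma f_image: "f ` T \<subseteq> carrier_vec m"
  using f by auto

lemma coefficient:
  assumes "q \<in> T"
  shows "V.lincomb a (f ` T) \<bullet> g q = a (f q) * (f q \<bullet> g q)"
proof -
  have "V.lincomb a (f ` T) \<bullet> g q = (\<Sum>p\<in>T. a (f p) * (f p \<bullet> g q))"
    using V.lincomb_scalar_prod [OF f_image g [OF assms]] by (simp add: sum.reindex [OF inj_on_f])
  also have "\<dots> = (\<Sum>p\<in>T. if p = q then a (f q) * (f q \<bullet> g q) else 0)"
    by (intro sum.cong refl) (use assms off_diagonal in auto)
  also have "\<dots> = a (f q) * (f q \<bullet> g q)"
    using fin assms by simp
  finally show ?thesis .
qed

lemma lin_indpt: "V.lin_indpt (f ` T)"
proof -
  have "\<forall>v\<in>f ` T. a v = 0" if "V.lincomb a (f ` T) = 0\<^sub>v m" for a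
    using that coefficient [of _ a] g diagonal by auto
  then show ?thesis
    using fin f_image by (intro V.finite_lin_indpt2) auto
qed

lemma lin_indep_family: "lin_indep_family m f T"
  unfolding lin_indep_family_def using inj_on_f f_image lin_indpt by blast

text \<open>
  If \<open>f\<close> has as many members as the dimension, then it is a basis, and \<open>x\<close> is a combination of
  those members whose dual vector is not orthogonal to \<open>x\<close>.
\<close>
lemma in_rspan:
  assumes "card T = m" "x \<in> carrier_vec m" "\<And>q. q \<in> T \<Longrightarrow> x \<bullet> g q \<noteq> 0 \<Longrightarrow> q \<in> S"
  shows "x \<in> rspan m (f ` (S \<inter> T))"
proof -
  have "V.basis (f ` T)"
    using fin f_image lin_indpt assms(1)
    by (intro V.dim_li_is_basis) (auto simp: V.dim_is_n card_image inj_on_f)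
  then have "x \<in> V.span (f ` T)"
    using assms(2) by (simp add: V.basis_def)
  then obtain a where x: "x = V.lincomb a (f ` T)"
    using V.finite_span [of "f ` T"] fin f_image by auto
  have a0: "a v = 0" if v: "v \<in> f ` T - f ` (S \<inter> T)" for v
  proof -
    from v obtain q where q: "v = f q" "q \<in> T" "q \<notin> S" by auto
    then have "x \<bullet> g q = 0" using assms(3) by blast
    with q coefficient [of q a] diagonal [of q] show ?thesis by (simp add: x)
  qed
  have "x = V.lincomb a (f ` (S \<inter> T))"
  proof (rule eq_vecI)
    fix i assume "i < dim_vec (V.lincomb a (f ` (S \<inter> T)))"
    then have i: "i < m" using fin f_image by (subst (asm) V.lincomb_dim) auto
    have "x $ i = (\<Sum>v\<in>f ` T. a v * v $ i)"
      unfolding x by (rule V.lincomb_index [OF i f_image])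
    also have "\<dots> = (\<Sum>v\<in>f ` (S \<inter> T). a v * v $ i)"
      by (rule sum.mono_neutral_right) (use fin a0 in auto)
    also have "\<dots> = V.lincomb a (f ` (S \<inter> T)) $ i"
      by (rule V.lincomb_index [OF i, symmetric]) (use f_image in auto)
    finally show "x $ i = V.lincomb a (f ` (S \<inter> T)) $ i" .
  next
    show "dim_vec x = dim_vec (V.lincomb a (f ` (S \<inter> T)))"
      using fin f_image assms(2) by (subst V.lincomb_dim) auto
  qed
  then show ?thesis
    unfolding rspan_def V.span_def using fin by blast
qed

end

lemma lin_indep_family_mono:
  assumes "lin_indep_family m f T" "S \<subseteq> T"
  shows "lin_indep_family m f S"
proof -
  interpret V: vec_space "TYPE(real)" m .
  show ?thesis
    using assms V.subset_li_is_li [of "f ` T" "f ` S"] inj_on_subset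
    unfolding lin_indep_family_def by blast
qed

section \<open>Modes and their dual vectors\<close>

lemma modes_eq:
  fixes N :: nat
  defines "I \<equiv> {1..N - 1}"
  shows "modes N = (\<lambda>(i, j, k). Interior1 i j k) ` (I \<times> I \<times> I) \<union>
    ((\<lambda>(i, j, k). Interior2 i j k) ` (I \<times> I \<times> I) \<union>
    ((\<lambda>(i, j, k). Kernel i j k) ` (I \<times> I \<times> I) \<union>
    ((\<lambda>(j, k). FaceX j k) ` (I \<times> I) \<union>
    ((\<lambda>(i, k). FaceY i k) ` (I \<times> I) \<union>
    (\<lambda>(i, j). FaceZ i j) ` (I \<times> I)))))" (is "_ = ?R")
proof
  show "modes N \<subseteq> ?R"
  proof
    fix p assume "p \<in> modes N"
    then show "p \<in> ?R" by (cases p) (auto simp: modes_def I_def image_iff)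
  qed
qed (auto simp: modes_def I_def)

lemma finite_modes: "finite (modes N)"
  unfolding modes_eq by simp

text \<open>
  With \<open>n = N - 1\<close> there are \<open>3 n\<^sup>3 + 3 n\<^sup>2\<close> modes, which is the dimension \<open>3 N n\<^sup>2\<close> of the
  whole space.
\<close>
lemma card_modes: "card (modes N) = 3 * len N"
proof (cases N)
  case (Suc n)
  define I where "I = {1..N - 1}"
  have I: "finite I" "card I = n" by (simp_all add: I_def Suc)
  have inj: "inj_on (\<lambda>(i, j, k). Interior1 i j k) A" "inj_on (\<lambda>(i, j, k). Interior2 i j k) A"
    "inj_on (\<lambda>(i, j, k). Kernel i j k) A" "inj_on (\<lambda>(j, k). FaceX j k) B"
    "inj_on (\<lambda>(j, k). FaceY j k) B" "inj_on (\<lambda>(j, k). FaceZ j k) B" for A B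
    by (auto simp: inj_on_def)
  have union: "card (A \<union> B) = a + b"
    if "finite A" "finite B" "A \<inter> B = {}" "card A = a" "card B = b" for A B :: "mode set" and a b
    using that by (simp add: card_Un_disjoint)
  have "card (modes N) = n ^ 3 + (n ^ 3 + (n ^ 3 + (n ^ 2 + (n ^ 2 + n ^ 2))))"
    unfolding modes_eq I_def [symmetric]
    by (intro union; (force simp: I)?;
        simp add: card_image inj I card_cartesian_product power2_eq_square power3_eq_cube)
  then show ?thesis
    by (simp add: len_def Suc power2_eq_square power3_eq_cube algebra_simps)
qed (auto simp: modes_eq len_def)

text \<open>
  The index triple of a mode, with 0 in the missing position for the face modes.
\<close>
fun mode_index :: "mode \<Rightarrow> nat \<times> nat \<times> nat" where
  "mode_index (Interior1 i j k) = (i, j, k)"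
| "mode_index (Interior2 i j k) = (i, j, k)"
| "mode_index (FaceX j k) = (0, j, k)"
| "mode_index (FaceY i k) = (i, 0, k)"
| "mode_index (FaceZ i j) = (i, j, 0)"
| "mode_index (Kernel i j k) = (i, j, k)"

text \<open>
  The coefficients of a mode with respect to the product vectors \<open>F1\<close>, \<open>F2\<close>, \<open>F3\<close> at its index
  triple.
\<close>
fun mode_coeffs :: "(nat \<Rightarrow> real) \<Rightarrow> mode \<Rightarrow> real \<times> real \<times> real" where
  "mode_coeffs d (Interior1 i j k) = (1, 0, - (d k / d i))"
| "mode_coeffs d (Interior2 i j k) = (0, 1, - (d k / d j))"
| "mode_coeffs d (FaceX j k) = (1, 0, 0)"
| "mode_coeffs d (FaceY i k) = (0, 1, 0)"
| "mode_coeffs d (FaceZ i j) = (0, 0, 1)"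
| "mode_coeffs d (Kernel i j k) = (1, 1, 1)"

text \<open>
  For an interior triple the three modes with this triple span a three-dimensional space. There
  the coefficients below are, up to positive factors, those of the basis dual to
  \<open>mode_coeffs\<close> for the scalar product of the mass matrix, which has the diagonal entries
  \<open>d j * d k\<close>, \<open>d i * d k\<close>, \<open>d i * d j\<close>. For a face triple the space is one-dimensional.
\<close>
fun dual_coeffs :: "(nat \<Rightarrow> real) \<Rightarrow> mode \<Rightarrow> real \<times> real \<times> real" where
  "dual_coeffs d (Interior1 i j k) = (d i * (d j + d k), - (d j * d k), - (d j * d k))"
| "dual_coeffs d (Interior2 i j k) = (- (d i * d k), d j * (d i + d k), - (d i * d k))"
| "dual_coeffs d (FaceX j k) = (1, 0, 0)"
| "dual_coeffs d (FaceY i k) = (0, 1, 0)"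
| "dual_coeffs d (FaceZ i j) = (0, 0, 1)"
| "dual_coeffs d (Kernel i j k) = (1, 1, 1)"

context gram_diagonalization
begin

text \<open>The vector triple with given coefficients with respect to the product bases at \<open>(i, j, k)\<close>.\<close>
fun triple :: "nat \<times> nat \<times> nat \<Rightarrow> real \<times> real \<times> real \<Rightarrow> real vec \<times> real vec \<times> real vec" where
  "triple (i, j, k) (a, b, c) = (a \<cdot>\<^sub>v F1 i j k, b \<cdot>\<^sub>v F2 i j k, c \<cdot>\<^sub>v F3 i j k)"

lemma stack_triple_carrier: "stack (triple x y) \<in> carrier_vec (3 * len N)"
  by (cases x; cases y) (simp add: stack_carrier del: stack.simps)

lemma mode_index_le:
  assumes "p \<in> modes N" "mode_index p = (i, j, k)"
  shows "i \<le> n" "j \<le> n" "k \<le> n"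
  using assms by (cases p; auto simp: modes_def)+

lemma mass_triple:
  assumes "i \<le> n" "j \<le> n" "k \<le> n"
  shows "mass N *\<^sub>v stack (triple (i, j, k) (a, b, c)) =
    stack (triple (i, j, k) (d j * d k * a, d i * d k * b, d i * d j * c))"
  using assms
  by (simp add: mass_mult_stack mult_mat_vec [where nr = "len N" and nc = "len N"]
      mass_blocks_F smult_smult_assoc mult.commute del: stack.simps)

lemma stiffness_triple:
  assumes "i \<le> n" "j \<le> n" "k \<le> n"
    and "i = 0 \<Longrightarrow> b = 0 \<and> c = 0" "j = 0 \<Longrightarrow> a = 0 \<and> c = 0" "k = 0 \<Longrightarrow> a = 0 \<and> b = 0"
  shows "stiffness N *\<^sub>v stack (triple (i, j, k) (a, b, c)) =
    stack (triple (i, j, k)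
      ((d j + d k) * a - d k * b - d j * c, (d i + d k) * b - d k * a - d i * c,
       (d i + d j) * c - d j * a - d i * b))"
proof -
  have zero: "M *\<^sub>v (0 \<cdot>\<^sub>v v) = e \<cdot>\<^sub>v (0 \<cdot>\<^sub>v v')"
    if "M \<in> carrier_mat (len N) (len N)" "v \<in> carrier_vec (len N)" "v' \<in> carrier_vec (len N)"
    for M v v' and e :: real
    using that by (intro eq_vecI) (auto simp: scalar_prod_def)
  have smult: "M *\<^sub>v (s \<cdot>\<^sub>v v) = s \<cdot>\<^sub>v (M *\<^sub>v v)"
    if "M \<in> carrier_mat (len N) (len N)" "v \<in> carrier_vec (len N)" for M v and s :: real
    using that by (rule mult_mat_vec)
  have sum3: "s \<cdot>\<^sub>v v + t \<cdot>\<^sub>v v + r \<cdot>\<^sub>v v = (s + t + r) \<cdot>\<^sub>v v" for s t r :: real and v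
    by (rule eq_vecI) (auto simp: algebra_simps)
  \<comment> \<open>Where an off-diagonal block needs a non-zero index, the coefficient vanishes at the index 0.\<close>
  have 12: "A12 N *\<^sub>v (b \<cdot>\<^sub>v F2 i j k) = (- d k * b) \<cdot>\<^sub>v F1 i j k"
    using assms upper_blocks_F(1) [of i j k] zero [of "A12 N" "F2 i j k" "F1 i j k" 0]
    by (cases "i = 0") (auto simp: smult smult_smult_assoc)
  have 13: "A13 N *\<^sub>v (c \<cdot>\<^sub>v F3 i j k) = (- d j * c) \<cdot>\<^sub>v F1 i j k"
    using assms upper_blocks_F(2) [of i j k] zero [of "A13 N" "F3 i j k" "F1 i j k" 0]
    by (cases "i = 0") (auto simp: smult smult_smult_assoc)
  have 23: "A23 N *\<^sub>v (c \<cdot>\<^sub>v F3 i j k) = (- d i * c) \<cdot>\<^sub>v F2 i j k"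
    using assms upper_blocks_F(3) [of i j k] zero [of "A23 N" "F3 i j k" "F2 i j k" 0]
    by (cases "j = 0") (auto simp: smult smult_smult_assoc)
  have 21: "A21 N *\<^sub>v (a \<cdot>\<^sub>v F1 i j k) = (- d k * a) \<cdot>\<^sub>v F2 i j k"
    using assms lower_blocks_F(1) [of i j k] zero [of "A21 N" "F1 i j k" "F2 i j k" 0]
    by (cases "j = 0") (auto simp: smult smult_smult_assoc)
  have 31: "A31 N *\<^sub>v (a \<cdot>\<^sub>v F1 i j k) = (- d j * a) \<cdot>\<^sub>v F3 i j k"
    using assms lower_blocks_F(2) [of i j k] zero [of "A31 N" "F1 i j k" "F3 i j k" 0]
    by (cases "k = 0") (auto simp: smult smult_smult_assoc)
  have 32: "A32 N *\<^sub>v (b \<cdot>\<^sub>v F2 i j k) = (- d i * b) \<cdot>\<^sub>v F3 i j k"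
    using assms lower_blocks_F(3) [of i j k] zero [of "A32 N" "F2 i j k" "F3 i j k" 0]
    by (cases "k = 0") (auto simp: smult smult_smult_assoc)
  have diag: "A11 N *\<^sub>v (a \<cdot>\<^sub>v F1 i j k) = ((d j + d k) * a) \<cdot>\<^sub>v F1 i j k"
    "A22 N *\<^sub>v (b \<cdot>\<^sub>v F2 i j k) = ((d i + d k) * b) \<cdot>\<^sub>v F2 i j k"
    "A33 N *\<^sub>v (c \<cdot>\<^sub>v F3 i j k) = ((d i + d j) * c) \<cdot>\<^sub>v F3 i j k"
    using assms by (simp_all add: smult diagonal_blocks_F smult_smult_assoc mult.commute)
  show ?thesis
    unfolding triple.simps
    by (subst stiffness_mult_stack; (simp del: stack.simps)?)
      (simp add: 12 13 23 21 31 32 diag sum3 algebra_simps del: stack.simps)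
qed

lemma scalar_prod_triple:
  assumes "i \<le> n" "j \<le> n" "k \<le> n" "i' \<le> n" "j' \<le> n" "k' \<le> n"
  shows "stack (triple (i, j, k) (a, b, c)) \<bullet> stack (triple (i', j', k') (a', b', c')) =
    (if (i, j, k) = (i', j', k')
     then a * a' * of_bool (j \<noteq> 0 \<and> k \<noteq> 0) + b * b' * of_bool (i \<noteq> 0 \<and> k \<noteq> 0)
       + c * c' * of_bool (i \<noteq> 0 \<and> j \<noteq> 0)
     else 0)"
proof -
  have scalar_prod_smult: "(s \<cdot>\<^sub>v v) \<bullet> (t \<cdot>\<^sub>v w) = s * t * (v \<bullet> w)"
    if "v \<in> carrier_vec (len N)" "w \<in> carrier_vec (len N)" for s t :: real and v w
    using that by simp
  have "stack (triple (i, j, k) (a, b, c)) \<bullet> stack (triple (i', j', k') (a', b', c')) =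
      (a \<cdot>\<^sub>v F1 i j k) \<bullet> (a' \<cdot>\<^sub>v F1 i' j' k') + (b \<cdot>\<^sub>v F2 i j k) \<bullet> (b' \<cdot>\<^sub>v F2 i' j' k') +
      (c \<cdot>\<^sub>v F3 i j k) \<bullet> (c' \<cdot>\<^sub>v F3 i' j' k')"
    unfolding triple.simps
    by (rule scalar_prod_stack [where l = "len N"]) (simp_all only: smult_carrier_vec F_carrier)
  then show ?thesis
    unfolding scalar_prod_smult [OF F_carrier(1) F_carrier(1)]
      scalar_prod_smult [OF F_carrier(2) F_carrier(2)] scalar_prod_smult [OF F_carrier(3) F_carrier(3)]
      scalar_prod_F [OF assms]
    by (cases "i = i'"; cases "j = j'"; cases "k = k'"; simp del: stack.simps)
qed

text \<open>
  The eigenvalue problem at a fixed index triple is a 3 by 3 system. An equation whose basis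
  vector vanishes (because one of the other two indices is 0) does not have to hold.
\<close>
lemma triple_eigen:
  assumes "i \<le> n" "j \<le> n" "k \<le> n"
    and "i = 0 \<Longrightarrow> b = 0 \<and> c = 0" "j = 0 \<Longrightarrow> a = 0 \<and> c = 0" "k = 0 \<Longrightarrow> a = 0 \<and> b = 0"
    and "j \<noteq> 0 \<Longrightarrow> k \<noteq> 0 \<Longrightarrow> (d j + d k) * a - d k * b - d j * c = lam * (d j * d k * a)"
    and "i \<noteq> 0 \<Longrightarrow> k \<noteq> 0 \<Longrightarrow> (d i + d k) * b - d k * a - d i * c = lam * (d i * d k * b)"
    and "i \<noteq> 0 \<Longrightarrow> j \<noteq> 0 \<Longrightarrow> (d i + d j) * c - d j * a - d i * b = lam * (d i * d j * c)"
  shows "stiffness N *\<^sub>v stack (triple (i, j, k) (a, b, c)) =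
    lam \<cdot>\<^sub>v (mass N *\<^sub>v stack (triple (i, j, k) (a, b, c)))"
proof -
  have zero: "s \<cdot>\<^sub>v 0\<^sub>v l = 0\<^sub>v l" for s :: real and l
    by (rule eq_vecI) auto
  have 1: "((d j + d k) * a - d k * b - d j * c) \<cdot>\<^sub>v F1 i j k = (lam * (d j * d k * a)) \<cdot>\<^sub>v F1 i j k"
    using assms(7) by (cases "j = 0 \<or> k = 0") (auto simp: F_eq_0(1) zero)
  have 2: "((d i + d k) * b - d k * a - d i * c) \<cdot>\<^sub>v F2 i j k = (lam * (d i * d k * b)) \<cdot>\<^sub>v F2 i j k"
    using assms(8) by (cases "i = 0 \<or> k = 0") (auto simp: F_eq_0(2) zero)
  have 3: "((d i + d j) * c - d j * a - d i * b) \<cdot>\<^sub>v F3 i j k = (lam * (d i * d j * c)) \<cdot>\<^sub>v F3 i j k"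
    using assms(9) by (cases "i = 0 \<or> j = 0") (auto simp: F_eq_0(3) zero)
  have K: "stiffness N *\<^sub>v stack (triple (i, j, k) (a, b, c)) = stack (triple (i, j, k)
      ((d j + d k) * a - d k * b - d j * c, (d i + d k) * b - d k * a - d i * c,
       (d i + d j) * c - d j * a - d i * b))"
    by (rule stiffness_triple) (fact assms)+
  show ?thesis
    unfolding K mass_triple [OF assms(1-3)]
    unfolding triple.simps 1 2 3 by (simp only: stack_smult [symmetric] smult_smult_assoc)
qed

lemmas mode_data = mode_index.simps mode_coeffs.simps dual_coeffs.simps mode_eigenvalue.simps

lemma mode_indices_pos:
  assumes "p \<in> modes N" "i \<in> mode_indices p"
  shows "d i > 0" "i \<le> n" "i \<noteq> 0"
  using assms d_pos [of i] by (force simp: modes_def)+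

text \<open>
  The dual coefficients also belong to the eigenvalue of the mode: the basis dual to
  an eigenbasis of a symmetric problem consists of eigenvectors.
\<close>
lemma stiffness_eq_mass:
  assumes p: "p \<in> modes N" and c: "c = mode_coeffs d p \<or> c = dual_coeffs d p"
  shows "stiffness N *\<^sub>v stack (triple (mode_index p) c) =
    mode_eigenvalue d p \<cdot>\<^sub>v (mass N *\<^sub>v stack (triple (mode_index p) c))"
proof (cases p)
  case (Interior1 i j k)
  with mode_indices_pos [OF p] have "d i > 0" "d j > 0" "d k > 0" "i \<le> n" "j \<le> n" "k \<le> n"
      "i \<noteq> 0" "j \<noteq> 0" "k \<noteq> 0"
    by auto
  with c Interior1 show ?thesis
    by (elim disjE; simp only: mode_data; intro triple_eigen; simp add: field_simps)
next
  case (Interior2 i j k)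
  with mode_indices_pos [OF p] have "d i > 0" "d j > 0" "d k > 0" "i \<le> n" "j \<le> n" "k \<le> n"
      "i \<noteq> 0" "j \<noteq> 0" "k \<noteq> 0"
    by auto
  with c Interior2 show ?thesis
    by (elim disjE; simp only: mode_data; intro triple_eigen; simp add: field_simps)
next
  case (Kernel i j k)
  with mode_indices_pos [OF p] have "d i > 0" "d j > 0" "d k > 0" "i \<le> n" "j \<le> n" "k \<le> n"
      "i \<noteq> 0" "j \<noteq> 0" "k \<noteq> 0"
    by auto
  with c Kernel show ?thesis
    by (elim disjE; simp only: mode_data; intro triple_eigen; simp add: field_simps)
next
  case (FaceX j k)
  with mode_indices_pos [OF p] have "d j > 0" "d k > 0" "j \<le> n" "k \<le> n" "j \<noteq> 0" "k \<noteq> 0" by auto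
  with c FaceX show ?thesis
    by (elim disjE; simp only: mode_data; intro triple_eigen; simp add: field_simps)
next
  case (FaceY j k)
  with mode_indices_pos [OF p] have "d j > 0" "d k > 0" "j \<le> n" "k \<le> n" "j \<noteq> 0" "k \<noteq> 0" by auto
  with c FaceY show ?thesis
    by (elim disjE; simp only: mode_data; intro triple_eigen; simp add: field_simps)
next
  case (FaceZ j k)
  with mode_indices_pos [OF p] have "d j > 0" "d k > 0" "j \<le> n" "k \<le> n" "j \<noteq> 0" "k \<noteq> 0" by auto
  with c FaceZ show ?thesis
    by (elim disjE; simp only: mode_data; intro triple_eigen; simp add: field_simps)
qed

lemma mode_index_eq_cases:
  assumes "p \<in> modes N" "p' \<in> modes N" "p \<noteq> p'" "mode_index p = mode_index p'"
  obtains i j k where "i \<le> n" "j \<le> n" "k \<le> n" "d i > 0" "d j > 0" "d k > 0"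
    "p \<in> {Interior1 i j k, Interior2 i j k, Kernel i j k}"
    "p' \<in> {Interior1 i j k, Interior2 i j k, Kernel i j k}"
proof -
  obtain i j k where "p \<in> {Interior1 i j k, Interior2 i j k, Kernel i j k}"
    "p' \<in> {Interior1 i j k, Interior2 i j k, Kernel i j k}"
    using assms mode_indices_pos(3) [OF assms(1)] mode_indices_pos(3) [OF assms(2)]
    by (cases p; cases p'; simp; blast)
  moreover from this have "{i, j, k} \<subseteq> mode_indices p" by auto
  moreover from this mode_indices_pos [OF assms(1)]
  have "d i > 0" "d j > 0" "d k > 0" "i \<le> n" "j \<le> n" "k \<le> n" by auto
  ultimately show thesis
    by (intro that)
qed

lemma mode_dual_orthogonal:
  assumes p: "p \<in> modes N" and p': "p' \<in> modes N" and "p \<noteq> p'"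
  shows "stack (triple (mode_index p) (mode_coeffs d p)) \<bullet>
      (mass N *\<^sub>v stack (triple (mode_index p') (dual_coeffs d p'))) = 0"
proof (cases "mode_index p = mode_index p'")
  case False
  obtain i j k where ip: "mode_index p = (i, j, k)" by (cases "mode_index p")
  obtain i' j' k' where ip': "mode_index p' = (i', j', k')" by (cases "mode_index p'")
  obtain a b c where cp: "mode_coeffs d p = (a, b, c)" by (cases "mode_coeffs d p")
  obtain a' b' c' where cp': "dual_coeffs d p' = (a', b', c')" by (cases "dual_coeffs d p'")
  note le = mode_index_le [OF p ip] mode_index_le [OF p' ip']
  show ?thesis
    unfolding ip ip' cp cp' mass_triple [OF le(4-6)] scalar_prod_triple [OF le]
    using False ip ip' by (simp only: if_False)
next
  case True
  obtain i j k where le: "i \<le> n" "j \<le> n" "k \<le> n" and pos: "d i > 0" "d j > 0" "d k > 0"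
    and modes: "p \<in> {Interior1 i j k, Interior2 i j k, Kernel i j k}"
      "p' \<in> {Interior1 i j k, Interior2 i j k, Kernel i j k}"
    by (rule mode_index_eq_cases [OF p p' \<open>p \<noteq> p'\<close> True])
  have "i \<noteq> 0" "j \<noteq> 0" "k \<noteq> 0"
    using modes(1) mode_indices_pos(3) [OF p] by auto
  then show ?thesis
    using modes \<open>p \<noteq> p'\<close> pos
    by (elim insertE emptyE; simp add: mass_triple scalar_prod_triple le field_simps
        del: stack.simps triple.simps)
qed

lemma mode_dual_pos:
  assumes p: "p \<in> modes N"
  shows "stack (triple (mode_index p) (mode_coeffs d p)) \<bullet>
      (mass N *\<^sub>v stack (triple (mode_index p) (dual_coeffs d p))) > 0"
proof (cases p)
  case (Interior1 i j k)
  with mode_indices_pos [OF p] have "d i > 0" "d j > 0" "d k > 0" "i \<le> n" "j \<le> n" "k \<le> n"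
      "i \<noteq> 0" "j \<noteq> 0" "k \<noteq> 0"
    by auto
  with Interior1 show ?thesis
    by (simp add: mass_triple scalar_prod_triple add_pos_pos del: stack.simps triple.simps)
next
  case (Interior2 i j k)
  with mode_indices_pos [OF p] have "d i > 0" "d j > 0" "d k > 0" "i \<le> n" "j \<le> n" "k \<le> n"
      "i \<noteq> 0" "j \<noteq> 0" "k \<noteq> 0"
    by auto
  with Interior2 show ?thesis
    by (simp add: mass_triple scalar_prod_triple add_pos_pos del: stack.simps triple.simps)
next
  case (Kernel i j k)
  with mode_indices_pos [OF p] have "d i > 0" "d j > 0" "d k > 0" "i \<le> n" "j \<le> n" "k \<le> n"
      "i \<noteq> 0" "j \<noteq> 0" "k \<noteq> 0"
    by auto
  with Kernel show ?thesis
    by (simp add: mass_triple scalar_prod_triple add_pos_pos del: stack.simps triple.simps)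
next
  case (FaceX i j)
  with mode_indices_pos [OF p] have "d i > 0" "d j > 0" "i \<le> n" "j \<le> n" "i \<noteq> 0" "j \<noteq> 0"
    by auto
  with FaceX show ?thesis
    by (simp add: mass_triple scalar_prod_triple del: stack.simps triple.simps)
next
  case (FaceY i j)
  with mode_indices_pos [OF p] have "d i > 0" "d j > 0" "i \<le> n" "j \<le> n" "i \<noteq> 0" "j \<noteq> 0"
    by auto
  with FaceY show ?thesis
    by (simp add: mass_triple scalar_prod_triple del: stack.simps triple.simps)
next
  case (FaceZ i j)
  with mode_indices_pos [OF p] have "d i > 0" "d j > 0" "i \<le> n" "j \<le> n" "i \<noteq> 0" "j \<noteq> 0"
    by auto
  with FaceZ show ?thesis
    by (simp add: mass_triple scalar_prod_triple del: stack.simps triple.simps)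
qed

section \<open>The listed solutions\<close>

lemma Q_unit_vec: "r < n \<Longrightarrow> Q *\<^sub>v unit_vec n r = q (Suc r)"
  using Q by (intro eq_vecI) (simp_all add: q_def scalar_prod_right_unit)

lemma kron_Q_unit_arr:
  assumes "i \<in> {1..n}" "j \<in> {1..n}" "k \<in> {1..n}"
  shows "(Q \<otimes>\<^sub>k Q \<otimes>\<^sub>k Q) *\<^sub>v unit_arr N i j k = q k \<otimes>\<^sub>v q j \<otimes>\<^sub>v q i"
proof -
  obtain r s t where "i = Suc r" "j = Suc s" "k = Suc t" and "r < n" "s < n" "t < n"
    using assms by (metis Suc_le_lessD atLeastAtMost_iff not0_implies_Suc not_one_le_zero)
  then show ?thesis
    using Q by (simp add: unit_arr_eq_vkron kron_mult_vkron Q_unit_vec)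
qed

lemma kron_Q_smult_unit_arr:
  assumes "i \<in> {1..n}" "j \<in> {1..n}" "k \<in> {1..n}"
  shows "- ((Q \<otimes>\<^sub>k Q \<otimes>\<^sub>k Q) *\<^sub>v (c \<cdot>\<^sub>v unit_arr N i j k)) = (- c) \<cdot>\<^sub>v (q k \<otimes>\<^sub>v q j \<otimes>\<^sub>v q i)"
proof -
  have "(Q \<otimes>\<^sub>k Q \<otimes>\<^sub>k Q) *\<^sub>v (c \<cdot>\<^sub>v unit_arr N i j k) = c \<cdot>\<^sub>v ((Q \<otimes>\<^sub>k Q \<otimes>\<^sub>k Q) *\<^sub>v unit_arr N i j k)"
    by (rule mult_mat_vec [where nr = "n * n * n" and nc = "n * n * n"])
      (use Q in \<open>auto intro!: carrier_matI carrier_vecI simp: unit_arr_def vec_arr_def\<close>)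
  then show ?thesis
    by (simp add: kron_Q_unit_arr [OF assms] uminus_smult_vec)
qed

lemma vec_mat_Q_unit_mat:
  assumes "i \<in> {1..n}" "j \<in> {1..n}"
  shows "vec_mat (Q * unit_mat N i j * transpose_mat Q) = q j \<otimes>\<^sub>v q i"
proof -
  obtain r s where ij: "i = Suc r" "j = Suc s" and rs: "r < n" "s < n"
    using assms by (metis Suc_le_lessD atLeastAtMost_iff not0_implies_Suc not_one_le_zero)
  have "Q * unit_mat N i j = mat n n (\<lambda>(a, b). if b = s then Q $$ (a, r) else 0)"
  proof (rule eq_matI)
    fix a b assume "a < dim_row (mat n n (\<lambda>(a, b). if b = s then Q $$ (a, r) else 0))"
      "b < dim_col (mat n n (\<lambda>(a, b). if b = s then Q $$ (a, r) else 0))"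
    then have ab: "a < n" "b < n" by simp_all
    then have "(Q * unit_mat N i j) $$ (a, b) =
        (\<Sum>c<n. Q $$ (a, c) * (if c = r \<and> b = s then 1 else 0))"
      using Q by (simp add: unit_mat_def scalar_prod_def ij lessThan_atLeast0)
    also have "\<dots> = (\<Sum>c<n. if c = r then (if b = s then Q $$ (a, r) else 0) else 0)"
      by (intro sum.cong) auto
    finally have "(Q * unit_mat N i j) $$ (a, b) =
        (\<Sum>c<n. if c = r then (if b = s then Q $$ (a, r) else 0) else 0)" .
    then show "(Q * unit_mat N i j) $$ (a, b) =
        mat n n (\<lambda>(a, b). if b = s then Q $$ (a, r) else 0) $$ (a, b)"
      using ab rs by simp
  qed (use Q in \<open>simp_all add: unit_mat_def\<close>)
  moreover have "mat n n (\<lambda>(a, b). if b = s then Q $$ (a, r) else 0) * transpose_mat Q =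
      mat (dim_vec (q i)) (dim_vec (q j)) (\<lambda>(a, b). q i $ a * q j $ b)" (is "?L = ?R")
  proof (rule eq_matI)
    fix a b assume "a < dim_row ?R" "b < dim_col ?R"
    then have ab: "a < n" "b < n" by simp_all
    then have "?L $$ (a, b) = (\<Sum>c<n. (if c = s then Q $$ (a, r) else 0) * Q $$ (b, c))"
      using Q by (simp add: scalar_prod_def lessThan_atLeast0)
    also have "\<dots> = (\<Sum>c<n. if c = s then Q $$ (a, r) * Q $$ (b, s) else 0)"
      by (intro sum.cong) auto
    finally have "?L $$ (a, b) = (\<Sum>c<n. if c = s then Q $$ (a, r) * Q $$ (b, s) else 0)" .
    then show "?L $$ (a, b) = ?R $$ (a, b)"
      using ab rs Q by (simp add: q_def ij)
  qed (use Q in simp_all)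
  ultimately show ?thesis by (simp only: vec_mat_outer)
qed

lemma assemble_interior:
  assumes "i \<noteq> 0" "j \<noteq> 0" "k \<noteq> 0"
  shows "assemble N (a \<cdot>\<^sub>v (q k \<otimes>\<^sub>v q j \<otimes>\<^sub>v q i))
      (b \<cdot>\<^sub>v (q k \<otimes>\<^sub>v q j \<otimes>\<^sub>v q i)) (c \<cdot>\<^sub>v (q k \<otimes>\<^sub>v q j \<otimes>\<^sub>v q i))
      (0\<^sub>v (n ^ 2)) (0\<^sub>v (n ^ 2)) (0\<^sub>v (n ^ 2)) = triple (i, j, k) (a, b, c)"
proof -
  have add: "v + 0\<^sub>v l = v" if "dim_vec v = l" for v :: "real vec" and l
    using that by (intro eq_vecI) auto
  show ?thesis
    unfolding assemble_def Let_def triple.simps F1_def F2_def F3_def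
    using assms by (simp add: mult_mat_smult_vec mult_mat_zero_vec add kron_simps power2_eq_square)
qed

lemma assemble_faces:
  "assemble N (0\<^sub>v (n ^ 3)) (0\<^sub>v (n ^ 3)) (0\<^sub>v (n ^ 3)) (q k \<otimes>\<^sub>v q j) (0\<^sub>v (n ^ 2)) (0\<^sub>v (n ^ 2)) =
    triple (0, j, k) (1, 0, 0)"
  "assemble N (0\<^sub>v (n ^ 3)) (0\<^sub>v (n ^ 3)) (0\<^sub>v (n ^ 3)) (0\<^sub>v (n ^ 2)) (q k \<otimes>\<^sub>v q i) (0\<^sub>v (n ^ 2)) =
    triple (i, 0, k) (0, 1, 0)"
  "assemble N (0\<^sub>v (n ^ 3)) (0\<^sub>v (n ^ 3)) (0\<^sub>v (n ^ 3)) (0\<^sub>v (n ^ 2)) (0\<^sub>v (n ^ 2)) (q j \<otimes>\<^sub>v q i) =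
    triple (i, j, 0) (0, 0, 1)"
proof -
  have add: "0\<^sub>v l + v = v" if "dim_vec v = l" for v :: "real vec" and l
    using that by (intro eq_vecI) auto
  have smult: "1 \<cdot>\<^sub>v v = v" "0 \<cdot>\<^sub>v v = 0\<^sub>v (dim_vec v)" for v :: "real vec"
    by (intro eq_vecI; simp)+
  \<comment> \<open>The missing factor of each two-fold product is supplied as \<open>unit_vec 1 0\<close>, which \<open>e1\<close>
    maps to \<open>h 0\<close>.\<close>
  have x: "(1\<^sub>m n \<otimes>\<^sub>k 1\<^sub>m n \<otimes>\<^sub>k e1 N) *\<^sub>v (q k \<otimes>\<^sub>v q j) = F1 0 j k"
    by (subst (2) vkron_one [symmetric]) (simp add: kron_simps e1_mult_h F1_def del: One_nat_def)
  have y: "(1\<^sub>m n \<otimes>\<^sub>k e1 N \<otimes>\<^sub>k 1\<^sub>m n) *\<^sub>v (q k \<otimes>\<^sub>v q i) = F2 i 0 k"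
    by (subst vkron_one [symmetric]) (simp add: kron_simps e1_mult_h F2_def del: One_nat_def)
  have z: "(e1 N \<otimes>\<^sub>k 1\<^sub>m n \<otimes>\<^sub>k 1\<^sub>m n) *\<^sub>v (q j \<otimes>\<^sub>v q i) = F3 i j 0"
    by (subst one_vkron [symmetric]) (simp add: kron_simps e1_mult_h F3_def del: One_nat_def)
  note dims = power2_eq_square power3_eq_cube len_def algebra_simps
  show "assemble N (0\<^sub>v (n ^ 3)) (0\<^sub>v (n ^ 3)) (0\<^sub>v (n ^ 3)) (q k \<otimes>\<^sub>v q j) (0\<^sub>v (n ^ 2)) (0\<^sub>v (n ^ 2)) =
    triple (0, j, k) (1, 0, 0)"
    "assemble N (0\<^sub>v (n ^ 3)) (0\<^sub>v (n ^ 3)) (0\<^sub>v (n ^ 3)) (0\<^sub>v (n ^ 2)) (q k \<otimes>\<^sub>v q i) (0\<^sub>v (n ^ 2)) =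
    triple (i, 0, k) (0, 1, 0)"
    "assemble N (0\<^sub>v (n ^ 3)) (0\<^sub>v (n ^ 3)) (0\<^sub>v (n ^ 3)) (0\<^sub>v (n ^ 2)) (0\<^sub>v (n ^ 2)) (q j \<otimes>\<^sub>v q i) =
    triple (i, j, 0) (0, 0, 1)"
    using carrier_vecD [OF F_carrier(1)] carrier_vecD [OF F_carrier(2)] carrier_vecD [OF F_carrier(3)]
    by (simp_all add: assemble_def x y z mult_mat_zero_vec add smult dims)
qed

lemma mode_solution_eq_triple:
  assumes p: "p \<in> modes N"
  shows "mode_solution N Q d p = triple (mode_index p) (mode_coeffs d p)"
proof -
  have smult: "1 \<cdot>\<^sub>v v = v" for v :: "real vec"
    by (intro eq_vecI; simp)
  have z3: "0\<^sub>v (n ^ 3) = 0 \<cdot>\<^sub>v (q k \<otimes>\<^sub>v q j \<otimes>\<^sub>v q i)" for i j k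
    by (rule eq_vecI) (simp_all add: power3_eq_cube)
  note solution = mode_solution.simps mode_index.simps mode_coeffs.simps Let_def diff_Suc_1
  show ?thesis
  proof (cases p)
    case (Interior1 i j k)
    then have *: "i \<in> {1..n}" "j \<in> {1..n}" "k \<in> {1..n}" using p by (simp_all add: modes_def)
    then show ?thesis
      unfolding Interior1 solution kron_Q_unit_arr [OF *] kron_Q_smult_unit_arr [OF *]
      using assemble_interior [of i j k 1 0 "- (d k / d i)"] by (simp add: smult z3 [of k j i])
  next
    case (Interior2 i j k)
    then have *: "i \<in> {1..n}" "j \<in> {1..n}" "k \<in> {1..n}" using p by (simp_all add: modes_def)
    then show ?thesis
      unfolding Interior2 solution kron_Q_unit_arr [OF *] kron_Q_smult_unit_arr [OF *]
      using assemble_interior [of i j k 0 1 "- (d k / d j)"] by (simp add: smult z3 [of k j i])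
  next
    case (Kernel i j k)
    then have *: "i \<in> {1..n}" "j \<in> {1..n}" "k \<in> {1..n}" using p by (simp_all add: modes_def)
    then show ?thesis
      unfolding Kernel solution kron_Q_unit_arr [OF *]
      using assemble_interior [of i j k 1 1 1] by (simp add: smult)
  next
    case (FaceX i j)
    then have *: "i \<in> {1..n}" "j \<in> {1..n}" using p by (simp_all add: modes_def)
    show ?thesis
      unfolding FaceX solution vec_mat_Q_unit_mat [OF *] by (rule assemble_faces)
  next
    case (FaceY i j)
    then have *: "i \<in> {1..n}" "j \<in> {1..n}" using p by (simp_all add: modes_def)
    show ?thesis
      unfolding FaceY solution vec_mat_Q_unit_mat [OF *] by (rule assemble_faces)
  next
    case (FaceZ i j)
    then have *: "i \<in> {1..n}" "j \<in> {1..n}" using p by (simp_all add: modes_def)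
    show ?thesis
      unfolding FaceZ solution vec_mat_Q_unit_mat [OF *] by (rule assemble_faces)
  qed
qed

abbreviation solution_vec :: "mode \<Rightarrow> real vec" where
  "solution_vec p \<equiv> stack (mode_solution N Q d p)"

text \<open>The family \<open>mass N *\<^sub>v dual_vec p\<close> is dual to the listed eigenvectors.\<close>
definition dual_vec :: "mode \<Rightarrow> real vec" where
  "dual_vec p = stack (triple (mode_index p) (dual_coeffs d p))"

lemma dual_vec_carrier: "dual_vec p \<in> carrier_vec (3 * len N)"
  unfolding dual_vec_def by (rule stack_triple_carrier)

lemma mass_dual_vec_carrier:
  assumes "p \<in> modes N"
  shows "mass N *\<^sub>v dual_vec p \<in> carrier_vec (3 * len N)"
proof -
  obtain i j k where i: "mode_index p = (i, j, k)" by (cases "mode_index p")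
  obtain a b c where c: "dual_coeffs d p = (a, b, c)" by (cases "dual_coeffs d p")
  show ?thesis
    unfolding dual_vec_def i c mass_triple [OF mode_index_le [OF assms i]]
    by (rule stack_triple_carrier)
qed

lemma biorthogonal_modes:
  "biorthogonal (3 * len N) (modes N) solution_vec (\<lambda>p. mass N *\<^sub>v dual_vec p)"
proof
  fix p assume p: "p \<in> modes N"
  show "solution_vec p \<in> carrier_vec (3 * len N)"
    unfolding mode_solution_eq_triple [OF p] by (rule stack_triple_carrier)
  show "mass N *\<^sub>v dual_vec p \<in> carrier_vec (3 * len N)"
    by (rule mass_dual_vec_carrier [OF p])
  show "solution_vec p \<bullet> (mass N *\<^sub>v dual_vec p) \<noteq> 0"
    using mode_dual_pos [OF p] unfolding mode_solution_eq_triple [OF p] dual_vec_def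
    by (metis less_irrefl)
  show "solution_vec p \<bullet> (mass N *\<^sub>v dual_vec p') = 0" if "p' \<in> modes N" "p \<noteq> p'" for p'
    unfolding mode_solution_eq_triple [OF p] dual_vec_def by (rule mode_dual_orthogonal [OF p that])
qed (rule finite_modes)

lemma eigen_solution_modes:
  assumes p: "p \<in> modes N"
  shows "eigen_solution N (mode_eigenvalue d p) (mode_solution N Q d p)"
proof -
  obtain u v w where uvw: "mode_solution N Q d p = (u, v, w)" by (cases "mode_solution N Q d p")
  have car: "u \<in> carrier_vec (len N)" "v \<in> carrier_vec (len N)" "w \<in> carrier_vec (len N)"
    using uvw unfolding mode_solution_eq_triple [OF p]
    by (cases "mode_index p"; cases "mode_coeffs d p"; auto)+
  have "stack (u, v, w) \<bullet> (mass N *\<^sub>v dual_vec p) \<noteq> 0"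
    using biorthogonal.diagonal [OF biorthogonal_modes p] unfolding uvw .
  moreover have "stack (0\<^sub>v (len N), 0\<^sub>v (len N), 0\<^sub>v (len N)) = 0\<^sub>v (3 * len N)"
    by (rule eq_vecI) auto
  ultimately have "(u, v, w) \<noteq> (0\<^sub>v (len N), 0\<^sub>v (len N), 0\<^sub>v (len N))"
    using scalar_prod_left_zero [OF mass_dual_vec_carrier [OF p]] by (metis (no_types))
  moreover have "stiffness N *\<^sub>v stack (u, v, w) =
      mode_eigenvalue d p \<cdot>\<^sub>v (mass N *\<^sub>v stack (u, v, w))"
    using stiffness_eq_mass [OF p disjI1 [OF refl]]
    unfolding mode_solution_eq_triple [OF p, symmetric] uvw .
  ultimately show ?thesis
    unfolding uvw eigen_solution.simps range_vec_arr len_eq using car by blast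
qed

text \<open>
  Pairing the eigenvalue equation of \<open>x\<close> with a dual vector and moving the symmetric stiffness
  matrix to the other side shows that the dual vectors which are not orthogonal to \<open>x\<close> all belong
  to the eigenvalue of \<open>x\<close>.
\<close>
lemma eigen_solution_in_rspan:
  assumes "eigen_solution N lam x"
  shows "stack x \<in> rspan (3 * len N)
    {solution_vec p | p. p \<in> modes N \<and> mode_eigenvalue d p = lam}"
proof -
  obtain u v w where x: "x = (u, v, w)" by (cases x)
  have car: "u \<in> carrier_vec (len N)" "v \<in> carrier_vec (len N)" "w \<in> carrier_vec (len N)"
    and eq: "stiffness N *\<^sub>v stack x = lam \<cdot>\<^sub>v (mass N *\<^sub>v stack x)"
    using assms unfolding x eigen_solution.simps range_vec_arr len_eq by blast+
  have X: "stack x \<in> carrier_vec (3 * len N)"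
    unfolding x by (rule stack_carrier [OF car])
  have "mode_eigenvalue d p = lam"
    if p: "p \<in> modes N" and nz: "stack x \<bullet> (mass N *\<^sub>v dual_vec p) \<noteq> 0" for p
  proof -
    let ?r = "dual_vec p"
    note r = dual_vec_carrier [of p]
    have Bx: "mass N *\<^sub>v stack x \<in> carrier_vec (3 * len N)"
      unfolding x mass_mult_stack [OF car] using car
      by (intro stack_carrier mult_mat_vec_carrier [where n = "len N"]) simp_all
    have "mode_eigenvalue d p * (stack x \<bullet> (mass N *\<^sub>v ?r)) = stack x \<bullet> (stiffness N *\<^sub>v ?r)"
      using stiffness_eq_mass [OF p disjI2 [OF refl]] X mass_dual_vec_carrier [OF p]
      by (simp add: dual_vec_def)
    also have "\<dots> = (stiffness N *\<^sub>v stack x) \<bullet> ?r"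
      by (rule stiffness_sym [OF X r, symmetric])
    also have "\<dots> = lam * ((mass N *\<^sub>v stack x) \<bullet> ?r)"
      unfolding eq using Bx r by simp
    also have "(mass N *\<^sub>v stack x) \<bullet> ?r = stack x \<bullet> (mass N *\<^sub>v ?r)"
      by (rule mass_sym [OF X r])
    finally show ?thesis using nz by simp
  qed
  then have "stack x \<in> rspan (3 * len N)
      (solution_vec ` ({p. mode_eigenvalue d p = lam} \<inter> modes N))"
    by (intro biorthogonal.in_rspan [OF biorthogonal_modes card_modes X]) simp
  also have "solution_vec ` ({p. mode_eigenvalue d p = lam} \<inter> modes N) =
      {solution_vec p | p. p \<in> modes N \<and> mode_eigenvalue d p = lam}"
    by blast
  finally show ?thesis .
qed

lemma mode_eigenvalue_pos:
  assumes p: "p \<in> modes N" and "\<forall>i j k. p \<noteq> Kernel i j k"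
  shows "mode_eigenvalue d p > 0"
  using assms(2) mode_indices_pos(1) [OF p] by (cases p) (auto intro!: add_pos_pos)

end

theorem theorem3p1:
  fixes N :: nat and Q :: "real mat" and d :: "nat \<Rightarrow> real"
  assumes "N \<ge> 2"
    and "Q \<in> carrier_mat (N - 1) (N - 1)"
    and "Q * transpose_mat Q = 1\<^sub>m (N - 1)"
    and "transpose_mat Q * Q = 1\<^sub>m (N - 1)"
    and "gram N = Q * mat_diag (N - 1) (\<lambda>r. d (Suc r)) * transpose_mat Q"
  shows
    "(\<forall>p \<in> modes N. eigen_solution N (mode_eigenvalue d p) (mode_solution N Q d p)) \<and>
     (\<forall>p \<in> modes N. (\<forall>i j k. p \<noteq> Kernel i j k) \<longrightarrow> mode_eigenvalue d p \<noteq> 0) \<and>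
     (\<forall>i \<in> {1..N - 1}. \<forall>j \<in> {1..N - 1}. \<forall>k \<in> {1..N - 1}.
        lin_indep_family (3 * len N) (\<lambda>p. stack (mode_solution N Q d p))
          {Interior1 i j k, Interior2 i j k}) \<and>
     lin_indep_family (3 * len N) (\<lambda>p. stack (mode_solution N Q d p)) (modes N) \<and>
     (\<forall>lam x. eigen_solution N lam x \<longrightarrow>
        stack x \<in> rspan (3 * len N)
          {stack (mode_solution N Q d p) | p. p \<in> modes N \<and> mode_eigenvalue d p = lam})"
proof -
  obtain n where N: "N = Suc n" using assms(1) by (cases N) auto
  interpret gram_diagonalization n Q d
    using assms by unfold_locales (simp_all add: N)
  have indep: "lin_indep_family (3 * len N) (\<lambda>p. stack (mode_solution N Q d p)) (modes N)"
    unfolding N by (rule biorthogonal.lin_indep_family [OF biorthogonal_modes])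
  have "{Interior1 i j k, Interior2 i j k} \<subseteq> modes N"
    if "i \<in> {1..N - 1}" "j \<in> {1..N - 1}" "k \<in> {1..N - 1}" for i j k
    using that by (simp add: modes_def)
  then have pairs: "\<forall>i \<in> {1..N - 1}. \<forall>j \<in> {1..N - 1}. \<forall>k \<in> {1..N - 1}.
      lin_indep_family (3 * len N) (\<lambda>p. stack (mode_solution N Q d p))
        {Interior1 i j k, Interior2 i j k}"
    by (intro ballI lin_indep_family_mono [OF indep])
  have nonzero: "\<forall>p \<in> modes N. (\<forall>i j k. p \<noteq> Kernel i j k) \<longrightarrow> mode_eigenvalue d p \<noteq> 0"
    using mode_eigenvalue_pos unfolding N by (metis less_irrefl)
  have solutions: "\<forall>p \<in> modes N. eigen_solution N (mode_eigenvalue d p) (mode_solution N Q d p)"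
    unfolding N by (intro ballI eigen_solution_modes)
  have complete: "\<forall>lam x. eigen_solution N lam x \<longrightarrow> stack x \<in> rspan (3 * len N)
      {stack (mode_solution N Q d p) | p. p \<in> modes N \<and> mode_eigenvalue d p = lam}"
    unfolding N by (intro allI impI eigen_solution_in_rspan)
  show ?thesis
    by (intro conjI solutions nonzero pairs indep complete)
qed

end
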